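(* Let $G=(V_P\cup V_L,E)$ be a point-line graph with $|V_L|\ge2$ and let $a_i\in\mathbb{S}^1$ for each $i\in V_L$. Then $G$ can be realised as a minimally infinitesimally fixed-intercept rigid line-concurrent framework such that each $i\in V_L$ is realised as the line with normal $a_i$ if and only if: $|E|=2|V_P|+|V_L|-1$; $a_i\ne a_j$ for each $ij\in E_{LL}$; and for all nonempty $F\subseteq E$, $$|F|\le2\nu_{V_P}(F)+\nu_{V_L}(F)-1-\sum_{H\in C((G[F])^P)}\bigl(2-\dim\langle a_j: ij\in F\cap E_{PL},\ i\in V(H)\rangle\bigr).$$
   Context: A point-line graph has vertex set partitioned into $V_P$ (points) and $V_L$ (lines), edges split into $E_{PP},E_{PL},E_{LL}$ by endpoint types (for $ij\in E_{PL}$ we write $i\in V_P$, $j\in V_L$). $\nu_Y(F)$ is the number of vertices of $Y$ incident to edges of $F$. $G[F]$ is the subgraph formed by the edges $F$ and their endpoints. For a point-line graph $K$, $K^P$ is the graph (possibly with loops) on the point vertices of $K$ obtained by deleting the line vertices and replacing each point-line edge $ij$ ($i$ a point vertex) by a loop at $i$. $C(H)$ denotes the set of connected components of a graph $H$. A line-concurrent framework is a point-line framework in $\mathbb{R}^2$ with points $p:V_P\to\mathbb{R}^2$ and lines $\{x:\langle x,a_j\rangle=0\}$, $a_j\in\mathbb{S}^1$, through the origin. Its infinitesimal motions are the solutions $(\dot p,\dot a)$, $\dot p:V_P\to\mathbb{R}^2$, $\dot a:V_L\to\mathbb{R}^2$, of $\langle p_i-p_j,\dot p_i-\dot p_j\rangle=0$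 ($ij\in E_{PP}$), $\langle p_i,\dot a_j\rangle+\langle\dot p_i,a_j\rangle=0$ ($ij\in E_{PL}$), $\langle a_i,\dot a_j\rangle+\langle\dot a_i,a_j\rangle=0$ ($ij\in E_{LL}$), $\langle a_i,\dot a_i\rangle=0$ ($i\in V_L$). It is infinitesimally fixed-intercept rigid if the only solutions are the infinitesimal rotations about the origin (a one-dimensional space); minimally so if moreover deleting any edge destroys this property.
   Formalization: The condition a_i ≠ a_j for ij in E_LL is strengthened to a_i ≠ ±a_j (distinct lines), since the literal claim fails for V_P empty, V_L = {1,2}, E = {12}, a_2 = −a_1: all the counts hold, but the edge's constraint is vacuous. *)

theory Defs
  imports "HOL-Analysis.Analysis"
begin

text \<open>Edges are two-element vertex sets, so the underlying graph is simple; \<open>VP\<close> may be empty.\<close>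

definition point_line_graph :: "'v set \<Rightarrow> 'v set \<Rightarrow> 'v set set \<Rightarrow> bool" where
  "point_line_graph VP VL E \<longleftrightarrow>
     finite VP \<and> finite VL \<and> VP \<inter> VL = {} \<and>
     (\<forall>e\<in>E. \<exists>u\<in>VP \<union> VL. \<exists>v\<in>VP \<union> VL. u \<noteq> v \<and> e = {u, v})"

definition num_incident :: "'v set \<Rightarrow> 'v set set \<Rightarrow> nat" where
  "num_incident Y F = card {v\<in>Y. \<exists>e\<in>F. v \<in> e}"

text \<open>A graph with loops is given by a vertex set and a set of edges, a loop at \<open>i\<close> being the
  edge \<open>{i, i} = {i}\<close>. Parallel loops are merged, which does not affect connected components.
  A component is represented by its vertex set.\<close>

definition adj_rel :: "'v set \<Rightarrow> 'v set set \<Rightarrow> ('v \<times> 'v) set" where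
  "adj_rel V D = {(u, v). u \<in> V \<and> v \<in> V \<and> {u, v} \<in> D}"

definition components_of_graph :: "'v set \<Rightarrow> 'v set set \<Rightarrow> 'v set set" where
  "components_of_graph V D = V // (adj_rel V D)\<^sup>*"

text \<open>Vertices and edges of \<open>(G[F])\<^sup>P\<close>: as \<open>G[F]\<close> has only the endpoints of \<open>F\<close> as vertices, so has
  \<open>(G[F])\<^sup>P\<close>.\<close>

definition point_verts :: "'v set \<Rightarrow> 'v set set \<Rightarrow> 'v set" where
  "point_verts VP F = {i\<in>VP. \<exists>e\<in>F. i \<in> e}"

definition point_edges :: "'v set \<Rightarrow> 'v set \<Rightarrow> 'v set set \<Rightarrow> 'v set set" where
  "point_edges VP VL F = {e\<in>F. e \<subseteq> VP} \<union> {{i} | i j. i \<in> VP \<and> j \<in> VL \<and> {i, j} \<in> F}"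

definition point_components :: "'v set \<Rightarrow> 'v set \<Rightarrow> 'v set set \<Rightarrow> 'v set set" where
  "point_components VP VL F = components_of_graph (point_verts VP F) (point_edges VP VL F)"

definition component_normals ::
    "'v set \<Rightarrow> 'v set set \<Rightarrow> ('v \<Rightarrow> real^2) \<Rightarrow> 'v set \<Rightarrow> (real^2) set" where
  "component_normals VL F a H = {a j | i j. i \<in> H \<and> j \<in> VL \<and> {i, j} \<in> F}"

text \<open>A line-concurrent framework is \<open>(G, p, a)\<close>; only the values of \<open>p\<close>, \<open>p'\<close> on \<open>VP\<close> and of
  \<open>a\<close>, \<open>a'\<close> on \<open>VL\<close> matter. A line determines its unit normal only up to sign, so lines \<open>i\<close>
  and \<open>j\<close> are distinct iff \<open>a i \<noteq> a j\<close> and \<open>a i \<noteq> - a j\<close>; for antipodal normals the constraint of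
  a line-line edge would be vacuous.\<close>

definition line_concurrent_framework ::
    "'v set \<Rightarrow> 'v set \<Rightarrow> 'v set set \<Rightarrow> ('v \<Rightarrow> real^2) \<Rightarrow> ('v \<Rightarrow> real^2) \<Rightarrow> bool" where
  "line_concurrent_framework VP VL E p a \<longleftrightarrow>
     point_line_graph VP VL E \<and> (\<forall>j\<in>VL. a j \<in> sphere 0 1)"

definition infinitesimal_motion ::
    "'v set \<Rightarrow> 'v set \<Rightarrow> 'v set set \<Rightarrow> ('v \<Rightarrow> real^2) \<Rightarrow> ('v \<Rightarrow> real^2) \<Rightarrow>
     ('v \<Rightarrow> real^2) \<Rightarrow> ('v \<Rightarrow> real^2) \<Rightarrow> bool" where
  "infinitesimal_motion VP VL E p a p' a' \<longleftrightarrow>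
     (\<forall>i\<in>VP. \<forall>j\<in>VP. {i, j} \<in> E \<longrightarrow> (p i - p j) \<bullet> (p' i - p' j) = 0) \<and>
     (\<forall>i\<in>VP. \<forall>j\<in>VL. {i, j} \<in> E \<longrightarrow> p i \<bullet> a' j + p' i \<bullet> a j = 0) \<and>
     (\<forall>i\<in>VL. \<forall>j\<in>VL. {i, j} \<in> E \<longrightarrow> a i \<bullet> a' j + a' i \<bullet> a j = 0) \<and>
     (\<forall>i\<in>VL. a i \<bullet> a' i = 0)"

definition rot90 :: "real^2 \<Rightarrow> real^2" where
  "rot90 x = vector [- (x $ 2), x $ 1]"

definition infinitesimal_rotation ::
    "'v set \<Rightarrow> 'v set \<Rightarrow> ('v \<Rightarrow> real^2) \<Rightarrow> ('v \<Rightarrow> real^2) \<Rightarrow>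
     ('v \<Rightarrow> real^2) \<Rightarrow> ('v \<Rightarrow> real^2) \<Rightarrow> bool" where
  "infinitesimal_rotation VP VL p a p' a' \<longleftrightarrow>
     (\<exists>w::real. (\<forall>i\<in>VP. p' i = w *\<^sub>R rot90 (p i)) \<and> (\<forall>j\<in>VL. a' j = w *\<^sub>R rot90 (a j)))"

definition inf_fixed_intercept_rigid ::
    "'v set \<Rightarrow> 'v set \<Rightarrow> 'v set set \<Rightarrow> ('v \<Rightarrow> real^2) \<Rightarrow> ('v \<Rightarrow> real^2) \<Rightarrow> bool" where
  "inf_fixed_intercept_rigid VP VL E p a \<longleftrightarrow>
     (\<forall>p' a'. infinitesimal_motion VP VL E p a p' a' \<longrightarrow>
        infinitesimal_rotation VP VL p a p' a')"

definition minimally_inf_fixed_intercept_rigid ::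
    "'v set \<Rightarrow> 'v set \<Rightarrow> 'v set set \<Rightarrow> ('v \<Rightarrow> real^2) \<Rightarrow> ('v \<Rightarrow> real^2) \<Rightarrow> bool" where
  "minimally_inf_fixed_intercept_rigid VP VL E p a \<longleftrightarrow>
     inf_fixed_intercept_rigid VP VL E p a \<and>
     (\<forall>e\<in>E. \<not> inf_fixed_intercept_rigid VP VL (E - {e}) p a)"

end

theory Submission
  imports Defs "HOL-Library.Function_Algebras"
begin

text \<open>Since \<open>a j \<bullet> a' j = 0\<close>, a motion is a vector in a space \<open>K\<close> of dimension \<open>2 |VP| + |VL|\<close>, and
  each edge \<open>e\<close> contributes one row. This row lies in a plane \<open>U e\<close> of \<open>K\<close> that does not depend on
  \<open>p\<close>, and a nonzero row spans the intersection of \<open>U e\<close> with the hyperplane orthogonal to the rotation of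
  \<open>(p, a)\<close>. The framework is minimally rigid iff the rows are independent and their number is
  \<open>dim K - 1\<close>. Independence forces \<open>|F| + 1 \<le> dim (\<Sum>e\<in>F. U e)\<close> for all nonempty \<open>F\<close>, and this dimension
  equals \<open>2 \<nu>P(F) + \<nu>L(F)\<close> minus the sum over the components. Conversely, by an argument of
  Lovasz, these inequalities imply that the intersections of the planes with a generic hyperplane are
  independent. A generic hyperplane becomes the orthogonal complement of a rotation after scaling
  the coordinates of the lines, which leaves all planes \<open>U e\<close> invariant.\<close>

section \<open>Generic hyperplane sections of planes\<close>

lemma dim_le_finite:
  fixes S T :: "'b::real_vector set"
  assumes "finite T" "S \<subseteq> span T"
  shows "dim S \<le> dim T"
proof -
  obtain A where A: "A \<subseteq> S" "independent A" "S \<subseteq> span A" "card A = dim S"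
    by (rule basis_exists)
  obtain B where B: "B \<subseteq> T" "independent B" "T \<subseteq> span B" "card B = dim T"
    by (rule basis_exists)
  have "A \<subseteq> span B"
    using A(1) assms(2) B(3) by (meson order_trans span_minimal subspace_span)
  with A(2) have "card A \<le> card B"
    using independent_span_bound finite_subset[OF B(1) assms(1)] by blast
  then show ?thesis using A B by simp
qed

lemma independent_card_le_dim_finite:
  fixes B T :: "'b::real_vector set"
  assumes "finite T" "independent B" "B \<subseteq> span T"
  shows "finite B" "card B \<le> dim T"
proof -
  show "finite B" using independent_span_bound assms by blast
  show "card B \<le> dim T"
    using dim_le_finite[OF assms(1,3)] dim_eq_card_independent[OF assms(2)] by simp
qed

lemma dim_insert_finite:
  fixes T :: "'b::real_vector set"
  assumes "finite T"
  shows "dim (insert x T) = (if x \<in> span T then dim T else Suc (dim T))"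
proof (cases "x \<in> span T")
  case True
  then show ?thesis using span_redundant span_eq_dim by (metis (full_types))
next
  case False
  obtain B where B: "B \<subseteq> T" "independent B" "T \<subseteq> span B" "card B = dim T"
    by (rule basis_exists)
  have sp: "span B = span T" using B by (simp add: span_eq span_superset span_mono order_trans)
  have "finite B" using B assms finite_subset by blast
  have nB: "x \<notin> span B" "x \<notin> B" using False sp span_base by auto
  have "independent (insert x B)" using B nB by (simp add: independent_insert)
  moreover have "span (insert x B) = span (insert x T)"
    using sp by (simp add: span_insert)
  ultimately have "dim (insert x T) = card (insert x B)"
    by (metis dim_eq_card)
  with nB \<open>finite B\<close> B False show ?thesis by simp
qed

lemma subset_span_if_dim_le:
  fixes S T :: "'b::real_vector set"
  assumes "finite T" "S \<subseteq> span T" "dim T \<le> dim S"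
  shows "T \<subseteq> span S"
proof (rule ccontr)
  assume "\<not> T \<subseteq> span S"
  then obtain x where x: "x \<in> T" "x \<notin> span S" by blast
  obtain A where A: "A \<subseteq> S" "independent A" "S \<subseteq> span A" "card A = dim S"
    by (rule basis_exists)
  have "x \<notin> span A" using x A by (meson span_mono subsetD)
  then have i: "independent (insert x A)" "x \<notin> A" using A span_base by (auto simp: independent_insert)
  have "insert x A \<subseteq> span T" using x A assms span_base by blast
  from independent_card_le_dim_finite[OF assms(1) i(1) this]
  show False using A i assms by auto
qed

section \<open>Generic vectors and functionals\<close>

lemma span_scale_cancel:
  fixes x :: "'b::real_vector"
  assumes "c *\<^sub>R x \<in> span S" "c \<noteq> 0"
  shows "x \<in> span S"
  using span_scale[OF assms(1), of "inverse c"] assms(2) by simp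

text \<open>Two points of the line through \<open>u\<close> in direction \<open>v\<close> would put
  \<open>v\<close>, and then \<open>u\<close>, into the span. A span that does not contain both thus
  excludes at most one \<open>t\<close>.\<close>

lemma ex_avoiding_spans:
  fixes u v :: "'b::real_vector"
  assumes "finite \<Y>"
  shows "\<exists>t. \<forall>Y\<in>\<Y>. {u, v} \<subseteq> span Y \<or> u + t *\<^sub>R v \<notin> span Y"
proof -
  define bad where "bad Y = {t. \<not> {u, v} \<subseteq> span Y \<and> u + t *\<^sub>R v \<in> span Y}" for Y
  have "t = t'" if "t \<in> bad Y" "t' \<in> bad Y" for t t' Y
  proof (rule ccontr)
    assume "t \<noteq> t'"
    have "(u + t *\<^sub>R v) - (u + t' *\<^sub>R v) \<in> span Y"
      using that unfolding bad_def by (blast intro: span_diff)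
    then have "(t - t') *\<^sub>R v \<in> span Y" by (simp add: algebra_simps)
    then have v: "v \<in> span Y" using \<open>t \<noteq> t'\<close> span_scale_cancel[of "t - t'" v Y] by simp
    have "u + t *\<^sub>R v - t *\<^sub>R v \<in> span Y"
      using that v unfolding bad_def by (blast intro: span_diff span_scale)
    with v that show False by (simp add: bad_def)
  qed
  then have "bad Y = {} \<or> (\<exists>t. bad Y = {t})" for Y by blast
  then have "finite (bad Y)" for Y by (metis finite.emptyI finite_insert)
  then have "finite (\<Union>Y\<in>\<Y>. bad Y)" using assms by blast
  then obtain t where "t \<notin> (\<Union>Y\<in>\<Y>. bad Y)" by (metis ex_new_if_finite infinite_UNIV_char_0)
  then show ?thesis unfolding bad_def by blast
qed

text \<open>A functional \<open>g\<close> that vanishes on \<open>X\<close> but not at the new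
  \<open>z\<close> is added to the previous \<open>h\<close>, with a factor \<open>t\<close> that
  avoids finitely many ratios.\<close>

lemma linear_functional_separating:
  fixes X Z :: "'b::real_vector set"
  assumes "finite Z" "Z \<inter> span X = {}"
  shows "\<exists>h::'b \<Rightarrow> real. linear h \<and> (\<forall>x\<in>X. h x = 0) \<and> (\<forall>z\<in>Z. h z \<noteq> 0)"
  using assms
proof (induction Z rule: finite_induct)
  case empty
  have "linear (\<lambda>x::'b. 0::real)" by (simp add: linear_iff)
  then show ?case by blast
next
  case (insert z Z)
  then obtain h :: "'b \<Rightarrow> real" where h: "linear h" "\<forall>x\<in>X. h x = 0" "\<forall>z\<in>Z. h z \<noteq> 0" by auto
  obtain B where B: "B \<subseteq> X" "independent B" "X \<subseteq> span B"
    by (metis basis_exists)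
  have zB: "z \<notin> span B" using insert.prems B by (metis Int_insert_left_if1 insert_not_empty span_mono subsetD)
  then have "independent (insert z B)" using B span_base by (simp add: independent_insert)
  then obtain g :: "'b \<Rightarrow> real" where g: "linear g" "\<forall>x\<in>insert z B. g x = (if x = z then 1 else 0)"
    using linear_independent_extend[of "insert z B" "\<lambda>x. if x = z then 1 else 0"] by blast
  have gB: "g x = 0" if "x \<in> B" for x using g that zB span_base by fastforce
  have gX: "g x = 0" if "x \<in> X" for x
    using linear_eq_0_on_span[OF g(1) gB] that B by blast
  have gz: "g z = 1" using g by simp
  obtain t where t: "t \<notin> (\<lambda>y. - h y / g y) ` insert z Z" "t \<noteq> 0"
    using ex_new_if_finite[OF infinite_UNIV_char_0, of "insert 0 ((\<lambda>y. - h y / g y) ` insert z Z)"]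
      insert.hyps by auto
  have lin: "linear (\<lambda>x. h x + t * g x)"
    by (rule linearI) (simp_all add: linear_add[OF h(1)] linear_add[OF g(1)] linear_cmul[OF h(1)]
        linear_cmul[OF g(1)] algebra_simps)
  have "h y + t * g y \<noteq> 0" if "y \<in> insert z Z" for y
  proof (cases "g y = 0")
    case True
    then show ?thesis using that h gz by auto
  next
    case False
    have "t \<noteq> - h y / g y" using t that by blast
    then show ?thesis using False by (auto simp: field_simps)
  qed
  then show ?case using lin h gX by (intro exI[of _ "\<lambda>x. h x + t * g x"]) auto
qed

text \<open>By induction on \<open>E\<close>: the functional \<open>h\<close> is forced to vanish at a vector \<open>x\<close> of the plane of one
  edge, chosen outside every span that does not contain the plane. For a tight \<open>F\<close> the inequality
  for \<open>insert f F\<close> shows that the plane of \<open>f\<close> is not contained in the span.\<close>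
lemma generic_hyperplane_section:
  fixes u v :: "'e \<Rightarrow> 'b::real_vector"
  assumes "finite E" "finite X" "finite Z" "Z \<inter> span X = {}"
    and "\<forall>F\<subseteq>E. F \<noteq> {} \<longrightarrow> card F + 1 + dim X \<le> dim (X \<union> (\<Union>e\<in>F. {u e, v e}))"
  shows "\<exists>h::'b \<Rightarrow> real. linear h \<and> (\<forall>x\<in>X. h x = 0) \<and> (\<forall>z\<in>Z. h z \<noteq> 0) \<and>
    (\<forall>e\<in>E. h (u e) \<noteq> 0 \<or> h (v e) \<noteq> 0) \<and>
    (\<forall>r. (\<forall>e\<in>E. r e \<in> span {u e, v e} \<and> h (r e) = 0 \<and> r e \<noteq> 0) \<longrightarrow>
       (\<forall>c. (\<Sum>e\<in>E. c e *\<^sub>R r e) \<in> span X \<longrightarrow> (\<forall>e\<in>E. c e = 0)))"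
  using assms
proof (induction E arbitrary: X Z rule: finite_induct)
  case empty
  then show ?case using linear_functional_separating[of Z X] by auto
next
  case (insert f E)
  define U where "U F = X \<union> (\<Union>e\<in>F. {u e, v e})" for F
  have finE: "finite F" if "F \<subseteq> E" for F using that insert.hyps finite_subset by blast
  have finU: "finite (U F)" if "F \<subseteq> E" for F using that finE insert.prems by (auto simp: U_def)
  have bound: "card F + 1 + dim X \<le> dim (U F)" if "F \<subseteq> insert f E" "F \<noteq> {}" for F
    using insert.prems(4) that by (simp add: U_def)
  \<comment> \<open>The plane of \<open>f\<close> is independent of \<open>X\<close>, so no span
    with at most one dimension more than \<open>X\<close> contains it.\<close>
  have f2: "dim X + 2 \<le> dim (X \<union> {u f, v f})"
    using bound[of "{f}"] by (simp add: U_def)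
  have not2: "\<not> {u f, v f} \<subseteq> span Y" if "finite Y" "X \<subseteq> span Y" "dim Y \<le> dim X + 1" for Y
  proof
    assume "{u f, v f} \<subseteq> span Y"
    then have "dim (X \<union> {u f, v f}) \<le> dim Y" using that by (intro dim_le_finite) auto
    then show False using f2 that by simp
  qed
  \<comment> \<open>The spans \<open>U F\<close>, with \<open>U {} = X\<close> among them, serve the
    inequalities; those of \<open>insert z X\<close> keep \<open>z\<close> outside the span of the
    enlarged \<open>X\<close>, by exchange.\<close>
  have "finite (U ` Pow E \<union> (\<lambda>z. insert z X) ` Z)" using insert by auto
  from ex_avoiding_spans[OF this, of "u f" "v f"] obtain t where
    t: "\<And>Y. Y \<in> U ` Pow E \<union> (\<lambda>z. insert z X) ` Z \<Longrightarrow> \<not> {u f, v f} \<subseteq> span Y \<Longrightarrow> u f + t *\<^sub>R v f \<notin> span Y"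
    by blast
  define x where "x = u f + t *\<^sub>R v f"
  have "X = U {}" by (simp add: U_def)
  then have "X \<in> U ` Pow E \<union> (\<lambda>z. insert z X) ` Z" by blast
  then have xX: "x \<notin> span X"
    using t[of X] not2[of X] insert.prems unfolding x_def by (simp add: span_superset)
  have dimX': "dim (insert x X) = dim X + 1" using xX insert.prems by (simp add: dim_insert_finite)
  \<comment> \<open>Hence \<open>v f\<close> can join \<open>Z\<close>: the functional is nonzero
    there, so its kernel meets the plane of \<open>f\<close> in the multiples of \<open>x\<close>
    only.\<close>
  have vx: "v f \<notin> span (insert x X)"
  proof
    assume v: "v f \<in> span (insert x X)"
    then have "x - t *\<^sub>R v f \<in> span (insert x X)"
      by (blast intro: span_diff span_scale span_base)
    then have "{u f, v f} \<subseteq> span (insert x X)" using v by (simp add: x_def)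
    then show False using not2[of "insert x X"] dimX' insert.prems span_superset[of "insert x X"] by auto
  qed
  have zx: "z \<notin> span (insert x X)" if "z \<in> Z" for z
  proof
    assume z: "z \<in> span (insert x X)"
    have zX: "z \<notin> span X" using that insert.prems by blast
    have "x \<in> span (insert z X)" using in_span_insert[OF z zX] .
    moreover have "\<not> {u f, v f} \<subseteq> span (insert z X)"
    proof (rule not2)
      show "finite (insert z X)" using insert.prems by simp
      show "X \<subseteq> span (insert z X)" using span_superset[of "insert z X"] by blast
      show "dim (insert z X) \<le> dim X + 1" using insert.prems zX by (simp add: dim_insert_finite)
    qed
    ultimately show False using t[of "insert z X"] that unfolding x_def by blast
  qed
  have step: "\<forall>F\<subseteq>E. F \<noteq> {} \<longrightarrow>
    card F + 1 + dim (insert x X) \<le> dim (insert x X \<union> (\<Union>e\<in>F. {u e, v e}))"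
  proof (intro allI impI)
    fix F assume F: "F \<subseteq> E" "F \<noteq> {}"
    have eq: "insert x X \<union> (\<Union>e\<in>F. {u e, v e}) = insert x (U F)" by (simp add: U_def)
    show "card F + 1 + dim (insert x X) \<le> dim (insert x X \<union> (\<Union>e\<in>F. {u e, v e}))"
    \<comment> \<open>Passing from \<open>X\<close> to \<open>insert x X\<close> costs one on the
      left. If the plane lies in the span, the inequality for \<open>insert f F\<close> pays for it,
      since \<open>f\<close> adds no dimension; otherwise \<open>x\<close> adds a dimension on the
      right.\<close>
    proof (cases "{u f, v f} \<subseteq> span (U F)")
      case True
      have "U (insert f F) \<subseteq> span (U F)" using True span_superset[of "U F"] by (auto simp: U_def)
      then have "dim (U (insert f F)) \<le> dim (U F)" using dim_le_finite finU F by blast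
      moreover have "card (insert f F) + 1 + dim X \<le> dim (U (insert f F))"
        using bound[of "insert f F"] F by auto
      moreover have "card (insert f F) = card F + 1" using F finE insert.hyps by (metis Suc_eq_plus1 card_insert_disjoint subsetD)
      moreover have "dim (U F) \<le> dim (insert x (U F))" using dim_insert_finite[OF finU[OF F(1)]] by simp
      ultimately show ?thesis unfolding eq dimX' by linarith
    next
      case False
      then have "x \<notin> span (U F)" using t[of "U F"] F unfolding x_def by blast
      then have "dim (insert x (U F)) = dim (U F) + 1" using dim_insert_finite[OF finU[OF F(1)]] by simp
      moreover have "card F + 1 + dim X \<le> dim (U F)" using bound F by blast
      ultimately show ?thesis unfolding eq dimX' by linarith
    qed
  qed
  have "finite (insert x X)" "finite (insert (v f) Z)" "insert (v f) Z \<inter> span (insert x X) = {}"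
    using insert.prems vx zx by auto
  from insert.IH[OF this step] obtain h :: "'b \<Rightarrow> real" where
    h: "linear h" "\<forall>y\<in>insert x X. h y = 0" "\<forall>z\<in>insert (v f) Z. h z \<noteq> 0"
    "\<forall>e\<in>E. h (u e) \<noteq> 0 \<or> h (v e) \<noteq> 0" and
    ind: "\<forall>r. (\<forall>e\<in>E. r e \<in> span {u e, v e} \<and> h (r e) = 0 \<and> r e \<noteq> 0) \<longrightarrow>
       (\<forall>c. (\<Sum>e\<in>E. c e *\<^sub>R r e) \<in> span (insert x X) \<longrightarrow> (\<forall>e\<in>E. c e = 0))"
    by (elim exE conjE) rule
  have "\<forall>e\<in>insert f E. c e = 0"
    if r: "\<forall>e\<in>insert f E. r e \<in> span {u e, v e} \<and> h (r e) = 0 \<and> r e \<noteq> 0"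
      and c: "(\<Sum>e\<in>insert f E. c e *\<^sub>R r e) \<in> span X" for r c
  proof -
    from r obtain \<alpha> \<beta> where ab: "r f = \<alpha> *\<^sub>R u f + \<beta> *\<^sub>R v f"
      by (auto simp: span_insert span_singleton algebra_simps)
    have e: "r f = \<alpha> *\<^sub>R x + (\<beta> - \<alpha> * t) *\<^sub>R v f" using ab by (simp add: x_def algebra_simps)
    \<comment> \<open>Since \<open>h\<close> vanishes at \<open>r f\<close> and \<open>x\<close> but
      not at \<open>v f\<close>, the vector \<open>r f\<close> is a multiple of \<open>x\<close>,
      which belongs to the new \<open>X\<close>.\<close>
    have "0 = h (\<alpha> *\<^sub>R x + (\<beta> - \<alpha> * t) *\<^sub>R v f)" using r e by simp
    also have "\<dots> = (\<beta> - \<alpha> * t) * h (v f)"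
      using h by (simp add: linear_add linear_cmul)
    finally have "\<beta> - \<alpha> * t = 0" using h(3) by simp
    with e have rx: "r f = \<alpha> *\<^sub>R x" by simp
    then have al: "\<alpha> \<noteq> 0" using r by auto
    have s: "(\<Sum>e\<in>insert f E. c e *\<^sub>R r e) = (c f * \<alpha>) *\<^sub>R x + (\<Sum>e\<in>E. c e *\<^sub>R r e)"
      using insert.hyps rx by simp
    have "(\<Sum>e\<in>E. c e *\<^sub>R r e) \<in> span (insert x X)"
    proof -
      have "(\<Sum>e\<in>insert f E. c e *\<^sub>R r e) - (c f * \<alpha>) *\<^sub>R x \<in> span (insert x X)"
        using c span_mono[of X "insert x X"] by (blast intro: span_diff span_scale span_base)
      then show ?thesis using s by simp
    qed
    then have cE: "\<forall>e\<in>E. c e = 0" using ind r by blast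
    then have "(c f * \<alpha>) *\<^sub>R x \<in> span X" using c s by simp
    then have "c f = 0" using xX al span_scale_cancel[of "c f * \<alpha>" x X] by auto
    with cE show ?thesis by simp
  qed
  then show ?case using h by (intro exI[of _ h]) auto
qed

section \<open>Configurations\<close>

text \<open>Configurations assign a vector to every element of the vertex type. As this type may be
  infinite, finiteness enters through generating sets.\<close>

instantiation "fun" :: (type, real_vector) real_vector
begin

definition "c *\<^sub>R f = (\<lambda>x. c *\<^sub>R f x)"

instance
  by standard (auto simp: scaleR_fun_def fun_eq_iff algebra_simps)

end

lemma scaleR_fun_apply [simp]: "(c *\<^sub>R f) x = c *\<^sub>R f x"
  by (simp add: scaleR_fun_def)

lemma sum_fun_apply [simp]: "(\<Sum>i\<in>I. f i) x = (\<Sum>i\<in>I. f i x)"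
  by (induction I rule: infinite_finite_induct) auto

definition delta :: "'v \<Rightarrow> 'b::zero \<Rightarrow> 'v \<Rightarrow> 'b" where
  "delta i x = (\<lambda>v. if v = i then x else 0)"

lemma delta_apply: "delta i x v = (if v = i then x else 0)"
  by (simp add: delta_def)

lemma linear_delta: "linear (delta i :: 'b::real_vector \<Rightarrow> 'v \<Rightarrow> 'b)"
  by (rule linearI) (auto simp: delta_def fun_eq_iff)

lemma delta_zero [simp]: "delta i (0::'b::real_vector) = 0"
  by (simp add: delta_def fun_eq_iff)

text \<open>Different vertices use independent coordinates, so embedded bases of the
  \<open>W i\<close> unite to a basis; evaluating a linear relation at \<open>i\<close> isolates the
  part from \<open>W i\<close>.\<close>

lemma dim_UN_delta:
  fixes W :: "'v \<Rightarrow> 'b::euclidean_space set"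
  assumes "finite S" "\<And>i. i \<in> S \<Longrightarrow> finite (W i)"
  shows "dim (\<Union>i\<in>S. delta i ` W i) = (\<Sum>i\<in>S. dim (W i))"
proof -
  have "\<exists>C. C \<subseteq> W i \<and> independent C \<and> W i \<subseteq> span C \<and> card C = dim (W i)" for i
    by (metis basis_exists)
  then obtain C where C: "\<And>i. C i \<subseteq> W i" "\<And>i. independent (C i)" "\<And>i. W i \<subseteq> span (C i)"
    "\<And>i. card (C i) = dim (W i)" by metis
  have finC: "finite (C i)" for i using C(2) by (rule finiteI_independent)
  have nz: "0 \<notin> C i" for i using C(2) dependent_zero by blast
  have inj: "inj_on (delta i) X" for i :: 'v and X :: "'b set"
    by (auto simp: inj_on_def delta_def fun_eq_iff)
  define B where "B = (\<Union>i\<in>S. delta i ` C i)"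
  have finB: "finite B" using assms finC by (simp add: B_def)
  have "card B = (\<Sum>i\<in>S. card (delta i ` C i))"
    unfolding B_def
  proof (rule card_UN_disjoint)
    show "\<forall>i\<in>S. \<forall>j\<in>S. i \<noteq> j \<longrightarrow> delta i ` C i \<inter> delta j ` C j = {}"
    proof (safe, rule ccontr)
      fix i j x y assume "i \<noteq> j" "x \<in> C i" "y \<in> C j" "delta i x = delta j y"
      then have "delta i x i = delta j y i" by simp
      then have "x = 0" using \<open>i \<noteq> j\<close> by (simp add: delta_def)
      then show False using \<open>x \<in> C i\<close> nz by blast
    qed
  qed (use assms finC in auto)
  then have cardB: "card B = (\<Sum>i\<in>S. dim (W i))" using C(4) inj by (simp add: card_image)
  have "independent B"
  proof (rule independent_if_scalars_zero[OF finB])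
    fix f x assume s: "(\<Sum>x\<in>B. f x *\<^sub>R x) = 0" and "x \<in> B"
    then obtain i b where ib: "i \<in> S" "b \<in> C i" "x = delta i b" by (auto simp: B_def)
    have "0 = (\<Sum>x\<in>B. f x *\<^sub>R x) i" using s by simp
    also have "\<dots> = (\<Sum>x\<in>B. f x *\<^sub>R x i)" by simp
    also have "\<dots> = (\<Sum>x\<in>delta i ` C i. f x *\<^sub>R x i)"
      by (rule sum.mono_neutral_right) (use finB ib in \<open>auto simp: B_def delta_apply split: if_splits\<close>)
    also have "\<dots> = (\<Sum>c\<in>C i. f (delta i c) *\<^sub>R c)"
      by (subst sum.reindex[OF inj]) (simp add: delta_apply)
    finally have "(\<Sum>c\<in>C i. f (delta i c) *\<^sub>R c) = 0" by simp
    then show "f x = 0"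
      using independentD[OF C(2) finC order_refl, of "\<lambda>c. f (delta i c)" i b] ib by blast
  qed
  moreover have "B \<subseteq> (\<Union>i\<in>S. delta i ` W i)" using C(1) by (auto simp: B_def)
  moreover have "(\<Union>i\<in>S. delta i ` W i) \<subseteq> span B"
  proof (clarsimp)
    fix i x assume ix: "i \<in> S" "x \<in> W i"
    have "delta i x \<in> delta i ` span (C i)" using ix C(3) by blast
    also have "\<dots> = span (delta i ` C i)" by (rule linear_span_image[OF linear_delta, symmetric])
    also have "\<dots> \<subseteq> span B" using ix by (intro span_mono) (auto simp: B_def)
    finally show "delta i x \<in> span B" .
  qed
  ultimately show ?thesis by (rule dim_unique[OF _ _ _ cardB, rotated 2])
qed

lemma dim_linear_image:
  fixes f :: "'b::real_vector \<Rightarrow> 'c::real_vector"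
  assumes "linear f" "inj f"
  shows "dim (f ` S) = dim S"
proof -
  obtain B where B: "B \<subseteq> S" "independent B" "S \<subseteq> span B" "card B = dim S"
    by (rule basis_exists)
  have "independent (f ` B)"
    using linear_independent_injective_image[OF assms(1) B(2)] assms(2) inj_on_subset by blast
  moreover have "f ` S \<subseteq> span (f ` B)"
    unfolding linear_span_image[OF assms(1)] using B by (intro image_mono)
  moreover have "card (f ` B) = dim S"
    using B assms by (metis card_image inj_on_subset subset_UNIV)
  ultimately show ?thesis using B dim_unique by (metis image_mono)
qed

section \<open>The inner product of configurations and orthogonal projection\<close>

definition pairing :: "'v set \<Rightarrow> ('v \<Rightarrow> 'b::real_inner) \<Rightarrow> ('v \<Rightarrow> 'b) \<Rightarrow> real" where
  "pairing V f g = (\<Sum>v\<in>V. f v \<bullet> g v)"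

lemma pairing_simps:
  "pairing V (f + g) k = pairing V f k + pairing V g k"
  "pairing V (f - g) k = pairing V f k - pairing V g k"
  "pairing V (c *\<^sub>R f) k = c * pairing V f k"
  "pairing V k (f + g) = pairing V k f + pairing V k g"
  "pairing V k (f - g) = pairing V k f - pairing V k g"
  "pairing V k (c *\<^sub>R f) = c * pairing V k f"
  "pairing V 0 k = 0" "pairing V k 0 = 0"
  by (simp_all add: pairing_def inner_simps sum.distrib sum_subtractf sum_distrib_left)

lemma pairing_commute: "pairing V f g = pairing V g f"
  by (simp add: pairing_def inner_commute)

lemma pairing_delta:
  assumes "finite V" "i \<in> V"
  shows "pairing V (delta i x) k = x \<bullet> k i"
proof -
  have "pairing V (delta i x) k = (\<Sum>v\<in>V. if v = i then x \<bullet> k i else 0)"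
    unfolding pairing_def by (intro sum.cong) (auto simp: delta_def)
  then show ?thesis using assms by simp
qed

lemma pairing_self_eq_0:
  assumes "finite V" "pairing V f f = 0" "v \<in> V"
  shows "f v = 0"
proof -
  have "\<forall>v\<in>V. f v \<bullet> f v = 0"
    using assms(2) sum_nonneg_eq_0_iff[OF assms(1), of "\<lambda>v. f v \<bullet> f v"] by (simp add: pairing_def)
  then show ?thesis using assms(3) by simp
qed

lemma pairing_span_eq_0:
  assumes "\<forall>g\<in>G. pairing V m g = 0" "x \<in> span G"
  shows "pairing V m x = 0"
  using assms(2)
proof (induction rule: span_induct_alt)
  case base
  show ?case by (rule pairing_simps)
next
  case (step c y z)
  then show ?case using assms(1) by (subst pairing_simps, subst pairing_simps) simp
qed

text \<open>Gram-Schmidt orthogonalisation, one generator at a time; \<open>k - z\<close> is the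
  part of the new generator \<open>k\<close> orthogonal to the earlier ones.\<close>

lemma ex_pairing_projection:
  assumes "finite V" "finite G"
  shows "\<exists>y\<in>span G. \<forall>g\<in>G. pairing V (x - y) g = 0"
  using assms(2)
proof (induction G arbitrary: x rule: finite_induct)
  case empty
  then show ?case by (intro bexI[of _ 0]) (auto simp: span_zero)
next
  case (insert k G)
  obtain y where y: "y \<in> span G" "\<forall>g\<in>G. pairing V (x - y) g = 0" using insert.IH by blast
  obtain z where z: "z \<in> span G" "\<forall>g\<in>G. pairing V (k - z) g = 0" using insert.IH by blast
  have mono: "span G \<subseteq> span (insert k G)" by (rule span_mono) blast
  define c where "c = (if pairing V (k - z) (k - z) = 0 then 0
    else pairing V (x - y) (k - z) / pairing V (k - z) (k - z))"
  define y' where "y' = y + c *\<^sub>R (k - z)"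
  have y'_span: "y' \<in> span (insert k G)"
    unfolding y'_def using y z mono
    by (intro span_add span_scale span_diff) (auto intro: span_base)
  have G0: "pairing V (x - y') g = 0" if "g \<in> G" for g
    using that y z by (simp add: y'_def pairing_simps)
  have "pairing V (x - y') (k - z) = 0"
  proof (cases "pairing V (k - z) (k - z) = 0")
    case True
    then have "\<forall>v\<in>V. (k - z) v = 0" using pairing_self_eq_0[OF assms(1)] by blast
    then show ?thesis unfolding pairing_def by (intro sum.neutral) auto
  next
    case False
    have "pairing V (x - y') (k - z) = pairing V (x - y) (k - z) - c * pairing V (k - z) (k - z)"
      by (simp add: y'_def pairing_simps algebra_simps)
    then show ?thesis using False by (simp add: c_def)
  qed
  moreover have "pairing V (x - y') z = 0"
    using pairing_span_eq_0[OF _ z(1)] G0 by blast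
  ultimately have "pairing V (x - y') k = 0" by (simp add: pairing_simps)
  then show ?case using G0 y'_span by blast
qed

section \<open>The dimension of the space spanned by the edge planes\<close>

lemma rot90_simps [simp]: "rot90 x $ 1 = - (x $ 2)" "rot90 x $ 2 = x $ 1"
  by (simp_all add: rot90_def)

lemma inner_2: "(x::real^2) \<bullet> y = x $ 1 * y $ 1 + x $ 2 * y $ 2"
  by (simp add: inner_vec_def sum_2)

lemma rot90_eq_0 [simp]: "rot90 x = 0 \<longleftrightarrow> x = 0"
  by (auto simp: vec_eq_iff forall_2)

text \<open>An orientation of the edges, with point-line edges directed from the point to the line.\<close>
locale oriented_point_line_graph =
  fixes VP VL :: "'v set" and E :: "'v set set" and s t :: "'v set \<Rightarrow> 'v"
    and a :: "'v \<Rightarrow> real^2"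
  assumes fin: "finite VP" "finite VL" and disj: "VP \<inter> VL = {}"
    and ends: "e \<in> E \<Longrightarrow> e = {s e, t e}" "e \<in> E \<Longrightarrow> s e \<noteq> t e"
    and kinds: "e \<in> E \<Longrightarrow> s e \<in> VP \<and> t e \<in> VP \<or> s e \<in> VP \<and> t e \<in> VL \<or> s e \<in> VL \<and> t e \<in> VL"
    and unit: "j \<in> VL \<Longrightarrow> norm (a j) = 1"
begin

text \<open>The only direction in which the normal of line \<open>j\<close> can move, its length
  being constant.\<close>

definition eps :: "'v \<Rightarrow> 'v \<Rightarrow> real^2" where
  "eps j = delta j (rot90 (a j))"

text \<open>\<open>u e\<close> and \<open>v e\<close> span the plane that contains the row of
  \<open>e\<close> for every \<open>p\<close>: the two axis differences, or the normal at the point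
  and the tangent at the line, or the tangents at both lines.\<close>

definition u :: "'v set \<Rightarrow> 'v \<Rightarrow> real^2" where
  "u e = (if t e \<in> VP then delta (s e) (axis 1 1) - delta (t e) (axis 1 1)
          else if s e \<in> VP then delta (s e) (a (t e)) else eps (s e))"

definition v :: "'v set \<Rightarrow> 'v \<Rightarrow> real^2" where
  "v e = (if t e \<in> VP then delta (s e) (axis 2 1) - delta (t e) (axis 2 1) else eps (t e))"

abbreviation edge_space :: "'v set set \<Rightarrow> ('v \<Rightarrow> real^2) set" where
  "edge_space F \<equiv> \<Union>e\<in>F. {u e, v e}"

lemma vec2_axis: "(b::real^2) = b $ 1 *\<^sub>R axis 1 1 + b $ 2 *\<^sub>R axis 2 1"
  by (auto simp: vec_eq_iff forall_2 axis_def)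

lemma delta_diff_in_span_uv:
  assumes "t e \<in> VP"
  shows "delta (s e) b - delta (t e) b \<in> span {u e, v e}"
proof -
  have "delta (s e) b - delta (t e) b = b $ 1 *\<^sub>R u e + b $ 2 *\<^sub>R v e"
    by (subst (1 2) vec2_axis[of b])
      (simp add: u_def v_def assms linear_add[OF linear_delta] linear_cmul[OF linear_delta] algebra_simps)
  then show ?thesis by (simp add: span_add span_scale span_base)
qed

section \<open>Representatives of components and a change of coordinates\<close>

context
  fixes F :: "'v set set"
  assumes F: "F \<subseteq> E"
begin

definition PV where "PV = point_verts VP F"
definition LV where "LV = {j\<in>VL. \<exists>e\<in>F. j \<in> e}"
definition conn where "conn = (adj_rel PV (point_edges VP VL F))\<^sup>*"
text \<open>The choice depends only on the class of \<open>x\<close>, so connected points share one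
  representative.\<close>

definition root where "root x = (SOME y. y \<in> conn `` {x})"

lemma PV_VP: "x \<in> PV \<Longrightarrow> x \<in> VP" and finPV: "finite PV" and finLV: "finite LV" and PVLV: "PV \<inter> LV = {}"
  using fin disj by (auto simp: PV_def LV_def point_verts_def)

lemma conn_sym: "(x, y) \<in> conn \<Longrightarrow> (y, x) \<in> conn"
proof -
  have "sym (adj_rel PV (point_edges VP VL F))"
    by (auto simp: sym_def adj_rel_def insert_commute)
  then show "(x, y) \<in> conn \<Longrightarrow> (y, x) \<in> conn"
    unfolding conn_def by (meson sym_rtrancl symD)
qed

lemma conn_image_eq: "(x, y) \<in> conn \<Longrightarrow> conn `` {x} = conn `` {y}"
proof -
  assume xy: "(x, y) \<in> conn"
  have "(x, z) \<in> conn \<longleftrightarrow> (y, z) \<in> conn" for z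
    using xy conn_sym[OF xy] unfolding conn_def by (metis rtrancl_trans)
  then show ?thesis by auto
qed

lemma conn_PV: "(x, y) \<in> conn \<Longrightarrow> x \<in> PV \<Longrightarrow> y \<in> PV"
  unfolding conn_def by (induction rule: rtrancl_induct) (auto simp: adj_rel_def)

lemma conn_root: "(x, root x) \<in> conn"
proof -
  have "(x, x) \<in> conn" by (simp add: conn_def)
  then show ?thesis unfolding root_def by (metis Image_singleton_iff someI_ex)
qed

lemma root_eq: "(x, y) \<in> conn \<Longrightarrow> root x = root y"
  using conn_image_eq unfolding root_def by metis

lemma root_root: "root (root x) = root x"
  using conn_root root_eq by metis

lemma root_PV: "x \<in> PV \<Longrightarrow> root x \<in> PV"
  using conn_root conn_PV by blast

text \<open>Every component contains exactly one root.\<close>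

lemma sum_components:
  "(\<Sum>H\<in>point_components VP VL F. g H) = (\<Sum>r\<in>{x\<in>PV. root x = x}. g (conn `` {r}))"
proof (rule sum.reindex_bij_betw[symmetric], rule bij_betwI')
  fix x y assume xy: "x \<in> {x\<in>PV. root x = x}" "y \<in> {x\<in>PV. root x = x}"
  have "root x = root y" if "conn `` {x} = conn `` {y}"
    unfolding root_def that ..
  then show "(conn `` {x} = conn `` {y}) = (x = y)" using xy by auto
next
  fix x assume "x \<in> {x\<in>PV. root x = x}"
  then show "conn `` {x} \<in> point_components VP VL F"
    unfolding point_components_def components_of_graph_def conn_def PV_def by (auto intro: quotientI)
next
  fix H assume "H \<in> point_components VP VL F"
  then obtain x where x: "x \<in> PV" "H = conn `` {x}"
    unfolding point_components_def components_of_graph_def conn_def PV_def by (auto elim: quotientE)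
  have "H = conn `` {root x}" using x(2) conn_image_eq[OF conn_root[of x]] by simp
  then show "\<exists>x\<in>{x\<in>PV. root x = x}. H = conn `` {x}"
    using root_root[of x] root_PV[OF x(1)] by blast
qed

text \<open>After the change of coordinates \<open>psi\<close>, the edge space splits over the
  vertices: a non-root is free, a root carries the normals of its component, and a line its
  tangent.\<close>

definition W where
  "W x = (if x \<in> PV then (if root x = x then component_normals VL F a (conn `` {x}) else Basis)
          else {rot90 (a x)})"

definition gens where "gens = (\<Union>x\<in>PV \<union> LV. delta x ` W x)"

text \<open>Subtracting the values of non-roots from the value at their root makes the condition that
  the values in a component sum to a vector in the span of its normals a condition on the root.\<close>
definition psi :: "('v \<Rightarrow> real^2) \<Rightarrow> 'v \<Rightarrow> real^2" where
  "psi f = f - (\<Sum>i\<in>{i\<in>PV. root i \<noteq> i}. delta (root i) (f i))"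

lemma linear_psi: "linear psi"
  by (rule linearI)
    (auto simp: psi_def fun_eq_iff delta_apply sum_subtractf sum.distrib[symmetric] scaleR_sum_right
      algebra_simps intro!: sum.cong)

text \<open>Only values at roots are changed. In the kernel all values at non-roots therefore
  vanish, which leaves nothing to subtract at the roots.\<close>

lemma inj_psi: "inj psi"
proof -
  have "f = 0" if f: "psi f = 0" for f
  proof -
    have eq: "f x - (\<Sum>i\<in>{i\<in>PV. root i \<noteq> i}. delta (root i) (f i) x) = 0" for x
      using fun_cong[OF f, of x] by (simp add: psi_def)
    have nonroot: "f x = 0" if x: "x \<in> PV" "root x \<noteq> x" for x
    proof -
      have "(\<Sum>i\<in>{i\<in>PV. root i \<noteq> i}. delta (root i) (f i) x) = 0"
        by (rule sum.neutral) (use x root_root in \<open>auto simp: delta_apply\<close>)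
      then show ?thesis using eq[of x] by simp
    qed
    have "(\<Sum>i\<in>{i\<in>PV. root i \<noteq> i}. delta (root i) (f i) x) = 0" for x
      by (rule sum.neutral) (use nonroot in \<open>auto simp: delta_apply\<close>)
    then show "f = 0" using eq by (auto simp: fun_eq_iff)
  qed
  then show ?thesis using linear_psi linear_injective_0 by blast
qed

lemma psi_delta:
  "psi (delta x b) = (if x \<in> PV \<and> root x \<noteq> x then delta x b - delta (root x) b else delta x b)"
proof -
  have "(\<Sum>i\<in>{i\<in>PV. root i \<noteq> i}. delta (root i) (delta x b i))
      = (\<Sum>i\<in>{i\<in>PV. root i \<noteq> i}. if i = x then delta (root x) b else 0)"
    by (rule sum.cong) (auto simp: delta_apply)
  then show ?thesis using finPV by (auto simp: psi_def)
qed

lemma finite_normals: "finite (component_normals VL F a H)"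
  using finite_subset[of "component_normals VL F a H" "a ` VL"] fin
  by (auto simp: component_normals_def)

lemma finite_W: "finite (W x)"
  by (simp add: W_def finite_normals)

text \<open>Counting two dimensions for every point overcounts at roots alone, by the codimension of
  the normals of their component. A line adds one.\<close>

lemma dim_gens:
  "int (dim gens) = 2 * int (card PV) + int (card LV)
     - (\<Sum>H\<in>point_components VP VL F. 2 - int (dim (component_normals VL F a H)))"
proof -
  let ?R = "{x\<in>PV. root x = x}"
  have "dim gens = (\<Sum>x\<in>PV \<union> LV. dim (W x))"
    unfolding gens_def using finPV finLV finite_W by (intro dim_UN_delta) auto
  also have "\<dots> = (\<Sum>x\<in>PV. dim (W x)) + (\<Sum>x\<in>LV. dim (W x))"
    using finPV finLV PVLV by (rule sum.union_disjoint)
  also have "(\<Sum>x\<in>LV. dim (W x)) = (\<Sum>x\<in>LV. 1)"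
  proof (rule sum.cong)
    fix x assume x: "x \<in> LV"
    then have "x \<notin> PV" "norm (a x) = 1" using PVLV unit by (auto simp: LV_def)
    then have "rot90 (a x) \<noteq> 0" "x \<notin> PV" by auto
    then show "dim (W x) = 1" by (simp add: W_def)
  qed simp
  finally have 1: "int (dim gens) = (\<Sum>x\<in>PV. int (dim (W x))) + int (card LV)" by simp
  have "(\<Sum>x\<in>PV. int (dim (W x))) = (\<Sum>x\<in>PV. 2 - (if root x = x then 2 - int (dim (W x)) else 0))"
    by (rule sum.cong) (auto simp: W_def dim_eq_card_independent[OF independent_Basis])
  also have "\<dots> = 2 * int (card PV) - (\<Sum>x\<in>PV. if root x = x then 2 - int (dim (W x)) else 0)"
    by (simp add: sum_subtractf)
  also have "(\<Sum>x\<in>PV. if root x = x then 2 - int (dim (W x)) else 0) = (\<Sum>x\<in>?R. 2 - int (dim (W x)))"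
    using finPV by (simp add: sum.inter_filter)
  also have "\<dots> = (\<Sum>x\<in>?R. 2 - int (dim (component_normals VL F a (conn `` {x}))))"
    by (rule sum.cong) (auto simp: W_def)
  also have "\<dots> = (\<Sum>H\<in>point_components VP VL F. 2 - int (dim (component_normals VL F a H)))"
    by (rule sum_components[symmetric])
  finally show ?thesis using 1 by simp
qed

text \<open>The difference telescopes along a path, each point-point edge supplying the difference
  of its ends for any \<open>b\<close>.\<close>

lemma delta_diff_conn:
  "(x, y) \<in> conn \<Longrightarrow> delta x b - delta y b \<in> span (edge_space F)"
  unfolding conn_def
proof (induction rule: rtrancl_induct)
  case base
  show ?case by (simp only: diff_self span_zero)
next
  case (step y z)
  have "delta y b - delta z b \<in> span (edge_space F)"
  \<comment> \<open>A step with distinct ends uses a point-point edge of \<open>F\<close>; a loop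
    contributes 0.\<close>
  proof (cases "y = z")
    case False
    have yz: "y \<in> VP" "z \<in> VP" "{y, z} \<in> F"
      using step.hyps(2) False PV_VP by (auto simp: adj_rel_def point_edges_def)
    let ?e = "{y, z}"
    have e: "?e = {s ?e, t ?e}" using ends yz F by blast
    have "t ?e \<in> VP" using e yz by (metis insertCI insert_iff singletonD)
    from delta_diff_in_span_uv[OF this, of b]
    have d: "delta (s ?e) b - delta (t ?e) b \<in> span (edge_space F)"
      using yz(3) span_mono[of "{u ?e, v ?e}" "edge_space F"] by blast
    consider "s ?e = y" "t ?e = z" | "s ?e = z" "t ?e = y" using e by (metis doubleton_eq_iff)
    then show ?thesis
    proof cases
      case 1
      then show ?thesis using d by simp
    next
      case 2
      then show ?thesis using span_neg[OF d] by simp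
    qed
  qed (simp add: span_zero)
  from span_add[OF step.IH this] show ?case by (simp only: diff_add_eq_diff_diff_swap diff_add_cancel add_diff_eq)
qed

lemma eps_edge_space:
  assumes "j \<in> VL" "e \<in> F" "j \<in> e"
  shows "eps j \<in> {u e, v e}"
proof -
  have e: "e = {s e, t e}" "e \<in> E" using ends assms F by auto
  then have "j = s e \<or> j = t e" using assms by blast
  then show ?thesis using kinds[OF e(2)] assms(1) disj by (auto simp: u_def v_def)
qed

text \<open>Membership is checked on generators. Differences along paths move a normal between its
  point and the root, and express each point by its root.\<close>

lemma span_psi_gens: "span (psi ` gens) = span (edge_space F)"
proof (rule span_eq[THEN iffD2], intro conjI)
  show "psi ` gens \<subseteq> span (edge_space F)"
  proof clarify
    fix f assume "f \<in> gens"
    then obtain x b where xb: "x \<in> PV \<union> LV" "b \<in> W x" "f = delta x b" by (auto simp: gens_def)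
    consider "x \<in> PV" "root x \<noteq> x" | "x \<in> PV" "root x = x" | "x \<in> LV" using xb by blast
    then show "psi f \<in> span (edge_space F)"
    proof cases
      case 1
      then show ?thesis using xb delta_diff_conn[OF conn_root] by (simp add: psi_delta)
    next
      case 2
      \<comment> \<open>The normal at the root \<open>x\<close> comes from a point-line edge at some
        point \<open>i\<close> of the component, and a path carries it from \<open>i\<close> to
        \<open>x\<close>.\<close>
      then obtain i j where ij: "(x, i) \<in> conn" "j \<in> VL" "{i, j} \<in> F" "b = a j"
        using xb by (auto simp: W_def component_normals_def)
      let ?e = "{i, j}"
      have e: "?e = {s ?e, t ?e}" "?e \<in> E" using ends F ij by auto
      have "i \<in> VP" using ij conn_PV 2 PV_VP by blast
      then have "s ?e = i" "t ?e = j" "j \<notin> VP"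
        using e kinds[OF e(2)] ij(2) disj by (metis disjoint_iff doubleton_eq_iff)+
      then have "delta i b = u ?e" using \<open>i \<in> VP\<close> ij by (simp add: u_def)
      then have "delta i b \<in> span (edge_space F)" using ij by (auto intro!: span_base)
      from span_add[OF delta_diff_conn[OF ij(1), of b] this] show ?thesis
        using 2 xb by (simp add: psi_delta)
    next
      case 3
      then have "x \<notin> PV" using PVLV by blast
      then have "f = eps x" using xb by (simp add: W_def eps_def)
      moreover obtain e where "e \<in> F" "x \<in> e" "x \<in> VL" using 3 by (auto simp: LV_def)
      ultimately have "f \<in> edge_space F" using eps_edge_space by blast
      then show ?thesis using xb \<open>x \<notin> PV\<close> by (simp add: psi_delta span_base)
    qed
  qed
next
  have base: "psi (delta x b) \<in> span (psi ` gens)" if "x \<in> PV \<union> LV" "b \<in> W x" for x b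
    using that by (auto simp: gens_def intro!: span_base)
  have diff: "delta x b - delta (root x) b \<in> span (psi ` gens)" if x: "x \<in> PV" for x and b :: "real^2"
  proof (cases "root x = x")
    case False
    have "b \<in> span Basis" by simp
    then show ?thesis
    proof (induction rule: span_induct_alt)
      case base
      show ?case by (simp only: delta_zero diff_self span_zero)
    next
      case (step c b b')
      have "delta x b - delta (root x) b \<in> span (psi ` gens)"
        using base[of x b] x False step(1) by (simp add: psi_delta W_def)
      from span_add[OF span_scale[OF this, of c] step(2)] show ?case
        by (simp only: linear_add[OF linear_delta] linear_cmul[OF linear_delta] algebra_simps)
    qed
  qed (simp add: span_zero)
  have line: "eps j \<in> span (psi ` gens)" if "e \<in> F" "j \<in> VL" "j \<in> e" for j e
  proof -
    have j: "j \<in> LV" "j \<notin> PV" using that PVLV by (auto simp: LV_def)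
    then show ?thesis using base[of j "rot90 (a j)"] by (simp add: W_def psi_delta eps_def)
  qed
  show "edge_space F \<subseteq> span (psi ` gens)"
  proof
    fix f assume "f \<in> edge_space F"
    then obtain e where eF: "e \<in> F" "f = u e \<or> f = v e" by blast
    then have e: "e = {s e, t e}" "e \<in> E" using ends F by auto
    have se: "s e \<in> e" "t e \<in> e" using e by auto
    have PVI: "x \<in> PV" if "x \<in> VP" "x \<in> e" for x
      using that eF by (auto simp: PV_def point_verts_def)
    consider "s e \<in> VP" "t e \<in> VP" | "s e \<in> VP" "t e \<in> VL" "t e \<notin> VP" | "s e \<in> VL" "t e \<in> VL" "s e \<notin> VP" "t e \<notin> VP"
      using kinds[OF e(2)] disj by blast
    then show "f \<in> span (psi ` gens)"
    proof cases
      case 1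
      \<comment> \<open>The ends of a point-point edge have a common root, so subtracting their
        differences to the root gives the difference of the ends.\<close>
      have "(s e, t e) \<in> conn"
        unfolding conn_def
        by (rule r_into_rtrancl) (use 1 PVI se e eF in \<open>auto simp: adj_rel_def point_edges_def\<close>)
      then have r: "root (s e) = root (t e)" by (rule root_eq)
      have "delta (s e) b - delta (t e) b \<in> span (psi ` gens)" for b :: "real^2"
        using span_diff[OF diff[of "s e" b] diff[of "t e" b]] 1 PVI se r by simp
      then show ?thesis using eF 1 by (auto simp: u_def v_def)
    next
      case 2
      have x: "s e \<in> PV" using 2 PVI se by blast
      have "a (t e) \<in> component_normals VL F a (conn `` {root (s e)})"
      proof -
        have "{s e, t e} \<in> F" using e eF by simp
        then show ?thesis
          unfolding component_normals_def using conn_sym[OF conn_root[of "s e"]] 2 by blast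
      qed
      then have "a (t e) \<in> W (root (s e))" using root_PV[OF x] by (simp add: W_def root_root)
      then have "delta (root (s e)) (a (t e)) \<in> span (psi ` gens)"
        using base[of "root (s e)" "a (t e)"] root_PV[OF x] by (simp add: psi_delta root_root)
      from span_add[OF diff[OF x, of "a (t e)"] this] have "delta (s e) (a (t e)) \<in> span (psi ` gens)"
        by simp
      then show ?thesis using eF 2 line[OF eF(1) 2(2) se(2)] by (auto simp: u_def v_def)
    next
      case 3
      then show ?thesis using eF line[OF eF(1) _ se(1)] line[OF eF(1) _ se(2)] by (auto simp: u_def v_def)
    qed
  qed
qed

lemma dim_edge_space:
  "int (dim (edge_space F)) = 2 * int (num_incident VP F) + int (num_incident VL F)
     - (\<Sum>H\<in>point_components VP VL F. 2 - int (dim (span (component_normals VL F a H))))"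
proof -
  have "dim (edge_space F) = dim (psi ` gens)" by (rule span_eq_dim[OF span_psi_gens, symmetric])
  also have "\<dots> = dim gens" by (rule dim_linear_image[OF linear_psi inj_psi])
  finally show ?thesis using dim_gens
    by (simp add: PV_def LV_def num_incident_def point_verts_def)
qed

end

end

section \<open>Rows and motions\<close>

lemma inner_rot90_swap: "x \<bullet> rot90 y = - (y \<bullet> rot90 x)"
  by (simp add: inner_2)

lemma rot90_inner_rot90 [simp]: "rot90 x \<bullet> rot90 y = x \<bullet> y"
  by (simp add: inner_2)

lemma inner_rot90_self [simp]: "x \<bullet> rot90 x = 0"
  by (simp add: inner_2)

lemma norm1_iff_2: "norm (x::real^2) = 1 \<longleftrightarrow> (x $ 1)\<^sup>2 + (x $ 2)\<^sup>2 = 1"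
  by (simp add: norm_eq_1 inner_2 power2_eq_square)

lemma perp_unit_eq:
  assumes "norm (x::real^2) = 1" "x \<bullet> y = 0"
  shows "y = (rot90 x \<bullet> y) *\<^sub>R rot90 x"
proof -
  have 1: "(x $ 1)\<^sup>2 + (x $ 2)\<^sup>2 = 1" "x $ 1 * y $ 1 + x $ 2 * y $ 2 = 0"
    using assms by (simp_all add: norm1_iff_2 inner_2)
  have "y $ 1 = (- x $ 2 * y $ 1 + x $ 1 * y $ 2) * (- x $ 2)" using 1 by algebra
  moreover have "y $ 2 = (- x $ 2 * y $ 1 + x $ 1 * y $ 2) * (x $ 1)" using 1 by algebra
  ultimately show ?thesis by (simp add: vec_eq_iff forall_2 inner_2)
qed

text \<open>Orthogonality to \<open>rot90 y\<close> makes \<open>x\<close> a multiple of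
  \<open>rot90 (rot90 y)\<close>, which is \<open>- y\<close>; unit length leaves the two
  signs.\<close>

lemma inner_rot90_eq_0_unit:
  assumes "norm (x::real^2) = 1" "norm y = 1"
  shows "x \<bullet> rot90 y = 0 \<longleftrightarrow> x = y \<or> x = - y"
proof
  assume "x \<bullet> rot90 y = 0"
  then have "rot90 y \<bullet> x = 0" by (simp add: inner_commute)
  moreover have "norm (rot90 y) = 1" using assms(2) by (simp add: norm_eq_1)
  ultimately have "x = (rot90 (rot90 y) \<bullet> x) *\<^sub>R rot90 (rot90 y)" by (intro perp_unit_eq) auto
  moreover have "rot90 (rot90 y) = - y" by (simp add: vec_eq_iff forall_2)
  ultimately have x: "x = (y \<bullet> x) *\<^sub>R y" by simp
  have "\<bar>y \<bullet> x\<bar> = norm x" using assms(2) by (subst x) simp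
  then have "y \<bullet> x = 1 \<or> y \<bullet> x = - 1" using assms by linarith
  then show "x = y \<or> x = - y" using x by (metis scaleR_minus1_left scaleR_one)
qed (auto simp: inner_2)

section \<open>The rows, the rotation and the space of candidate motions\<close>

context oriented_point_line_graph
begin

abbreviation pair :: "('v \<Rightarrow> real^2) \<Rightarrow> ('v \<Rightarrow> real^2) \<Rightarrow> real" where
  "pair \<equiv> pairing (VP \<union> VL)"

text \<open>The value 0 off the graph keeps the rotation in the span of \<open>motion_gens\<close>,
  the space of candidate motions.\<close>

definition rotation :: "('v \<Rightarrow> real^2) \<Rightarrow> 'v \<Rightarrow> real^2" where
  "rotation p x = (if x \<in> VP then rot90 (p x) else if x \<in> VL then rot90 (a x) else 0)"

text \<open>On motions, \<open>a' j\<close> is \<open>rot90 (a j) \<bullet> a' j\<close> times \<open>rot90 (a j)\<close>, and the rows are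
  the edge constraints written in this form.\<close>
definition row :: "('v \<Rightarrow> real^2) \<Rightarrow> 'v set \<Rightarrow> 'v \<Rightarrow> real^2" where
  "row p e = (if t e \<in> VP then delta (s e) (p (s e) - p (t e)) - delta (t e) (p (s e) - p (t e))
     else if s e \<in> VP then delta (s e) (a (t e)) + (p (s e) \<bullet> rot90 (a (t e))) *\<^sub>R eps (t e)
     else (a (s e) \<bullet> rot90 (a (t e))) *\<^sub>R (eps (t e) - eps (s e)))"

definition motion_gens :: "('v \<Rightarrow> real^2) set" where
  "motion_gens = (\<Union>x\<in>VP \<union> VL. delta x ` (if x \<in> VP then Basis else {rot90 (a x)}))"

lemma edge_cases:
  assumes "e \<in> E"
  obtains (PP) "s e \<in> VP" "t e \<in> VP" "s e \<notin> VL" "t e \<notin> VL"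
    | (PL) "s e \<in> VP" "t e \<in> VL" "s e \<notin> VL" "t e \<notin> VP"
    | (LL) "s e \<in> VL" "t e \<in> VL" "s e \<notin> VP" "t e \<notin> VP"
  using kinds[OF assms] disj by blast

lemma VL_not_VP: "j \<in> VL \<Longrightarrow> j \<notin> VP"
  using disj by blast

lemma finE: "finite E"
proof (rule finite_subset)
  show "E \<subseteq> Pow (VP \<union> VL)"
  proof
    fix e assume e: "e \<in> E"
    have "{s e, t e} \<subseteq> VP \<union> VL" using kinds[OF e] by blast
    then show "e \<in> Pow (VP \<union> VL)" using ends(1)[OF e] by simp
  qed
qed (use fin in simp)

lemma fin_motion_gens: "finite motion_gens"
  using fin by (simp add: motion_gens_def)

lemma dim_motion_gens: "dim motion_gens = 2 * card VP + card VL"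
proof -
  have "dim motion_gens = (\<Sum>x\<in>VP \<union> VL. dim (if x \<in> VP then Basis else {rot90 (a x)}))"
    unfolding motion_gens_def using fin by (intro dim_UN_delta) auto
  also have "\<dots> = (\<Sum>x\<in>VP. dim (if x \<in> VP then Basis else {rot90 (a x)}))
      + (\<Sum>x\<in>VL. dim (if x \<in> VP then Basis else {rot90 (a x)}))"
    using fin disj by (rule sum.union_disjoint)
  also have "(\<Sum>x\<in>VP. dim (if x \<in> VP then Basis else {rot90 (a x)})) = (\<Sum>x\<in>VP. 2)"
    by (rule sum.cong) (auto simp: dim_eq_card_independent[OF independent_Basis])
  also have "(\<Sum>x\<in>VL. dim (if x \<in> VP then Basis else {rot90 (a x)})) = (\<Sum>x\<in>VL. 1)"
  proof (rule sum.cong)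
    fix x assume x: "x \<in> VL"
    then have "rot90 (a x) \<noteq> 0" using unit[OF x] by auto
    then show "dim (if x \<in> VP then Basis else {rot90 (a x)}) = 1" using VL_not_VP[OF x] by simp
  qed simp
  finally show ?thesis by simp
qed

lemma pair_delta: "x \<in> VP \<union> VL \<Longrightarrow> pair (delta x b) f = b \<bullet> f x"
  using fin by (simp add: pairing_delta)

lemma pair_eps: "j \<in> VL \<Longrightarrow> pair (eps j) f = rot90 (a j) \<bullet> f j"
  by (simp add: pair_delta eps_def)

text \<open>Value 1 at all tangents characterises the pairings with rotations among functionals on
  candidate motions, since \<open>p\<close> can be fitted to any values at points.\<close>

lemma pair_eps_rotation: "j \<in> VL \<Longrightarrow> pair (eps j) (rotation p) = 1"
  using unit[of j] VL_not_VP[of j] by (simp add: pair_eps rotation_def norm_eq_1)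

lemma delta_motion_gens: "x \<in> VP \<Longrightarrow> delta x b \<in> span motion_gens"
proof -
  assume x: "x \<in> VP"
  have "delta x b \<in> delta x ` span Basis" by simp
  also have "delta x ` span Basis = span (delta x ` Basis)"
    by (rule linear_span_image[OF linear_delta, symmetric])
  also have "\<dots> \<subseteq> span motion_gens"
    using x by (intro span_mono) (auto simp: motion_gens_def)
  finally show ?thesis .
qed

lemma eps_motion_gens: "j \<in> VL \<Longrightarrow> eps j \<in> span motion_gens"
  using VL_not_VP[of j] by (intro span_base) (auto simp: motion_gens_def eps_def)

lemma in_span_motion_gens_iff:
  "f \<in> span motion_gens \<longleftrightarrow> (\<forall>x. x \<notin> VP \<union> VL \<longrightarrow> f x = 0) \<and> (\<forall>j\<in>VL. a j \<bullet> f j = 0)"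
proof
  assume "f \<in> span motion_gens"
  then show "(\<forall>x. x \<notin> VP \<union> VL \<longrightarrow> f x = 0) \<and> (\<forall>j\<in>VL. a j \<bullet> f j = 0)"
  proof (induction rule: span_induct_alt)
    case base
    show ?case by (simp add: zero_fun_def)
  next
    case (step c f g)
    have "(\<forall>x. x \<notin> VP \<union> VL \<longrightarrow> f x = 0) \<and> (\<forall>j\<in>VL. a j \<bullet> f j = 0)"
      using step(1) VL_not_VP by (auto simp: motion_gens_def delta_apply split: if_splits)
    then show ?case using step(2) by (auto simp: inner_simps)
  qed
next
  assume f: "(\<forall>x. x \<notin> VP \<union> VL \<longrightarrow> f x = 0) \<and> (\<forall>j\<in>VL. a j \<bullet> f j = 0)"
  have "(\<Sum>x\<in>VP \<union> VL. delta x (f x)) \<in> span motion_gens"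
  proof (rule span_sum)
    fix x assume "x \<in> VP \<union> VL"
    then consider "x \<in> VP" | "x \<in> VL" by blast
    then show "delta x (f x) \<in> span motion_gens"
    proof cases
      case 2
      have "delta x (f x) = delta x ((rot90 (a x) \<bullet> f x) *\<^sub>R rot90 (a x))"
        using perp_unit_eq[OF unit[OF 2]] f 2 by simp
      also have "\<dots> = (rot90 (a x) \<bullet> f x) *\<^sub>R eps x"
        by (simp only: linear_cmul[OF linear_delta] eps_def)
      finally show ?thesis using span_scale[OF eps_motion_gens[OF 2]] by simp
    qed (rule delta_motion_gens)
  qed
  moreover have "(\<Sum>x\<in>VP \<union> VL. delta x (f x)) = f"
  proof
    fix y
    have "(\<Sum>x\<in>VP \<union> VL. delta x (f x)) y = (\<Sum>x\<in>VP \<union> VL. if y = x then f x else 0)"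
      by (simp add: delta_apply)
    then show "(\<Sum>x\<in>VP \<union> VL. delta x (f x)) y = f y" using f fin by simp
  qed
  ultimately show "f \<in> span motion_gens" by simp
qed

lemma rotation_motion_gens: "rotation p \<in> span motion_gens"
  using VL_not_VP by (auto simp: in_span_motion_gens_iff rotation_def)

lemma uv_motion_gens: "e \<in> E \<Longrightarrow> {u e, v e} \<subseteq> span motion_gens"
  by (erule edge_cases) (auto simp: u_def v_def intro!: span_diff delta_motion_gens eps_motion_gens)

lemma row_in_span: "e \<in> E \<Longrightarrow> row p e \<in> span {u e, v e}"
proof (erule edge_cases)
  assume "t e \<in> VP"
  then show ?thesis using delta_diff_in_span_uv by (simp add: row_def)
next
  assume "s e \<in> VP" "t e \<notin> VP"
  then have "row p e = u e + (p (s e) \<bullet> rot90 (a (t e))) *\<^sub>R v e" by (simp add: row_def u_def v_def)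
  then show ?thesis by (simp add: span_add span_scale span_base)
next
  assume "s e \<notin> VP" "t e \<notin> VP"
  then have "row p e = (a (s e) \<bullet> rot90 (a (t e))) *\<^sub>R (v e - u e)" by (simp add: row_def u_def v_def)
  then show ?thesis by (simp add: span_diff span_scale span_base)
qed

lemma row_motion_gens: "e \<in> E \<Longrightarrow> row p e \<in> span motion_gens"
  using row_in_span[of e p] span_minimal[OF uv_motion_gens subspace_span, of e] by blast

lemma pair_row:
  assumes "e \<in> E"
  shows "pair (row p e) m = (if t e \<in> VP then (p (s e) - p (t e)) \<bullet> (m (s e) - m (t e))
     else if s e \<in> VP then a (t e) \<bullet> m (s e) + (p (s e) \<bullet> rot90 (a (t e))) * (rot90 (a (t e)) \<bullet> m (t e))
     else (a (s e) \<bullet> rot90 (a (t e))) * (rot90 (a (t e)) \<bullet> m (t e) - rot90 (a (s e)) \<bullet> m (s e)))"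
  using assms by (cases rule: edge_cases) (simp_all add: row_def pairing_simps pair_delta pair_eps inner_diff_right)

text \<open>The rotation preserves distances of points, products of points with normals and products
  of normals, which are what the edges constrain.\<close>

lemma pair_row_rotation:
  assumes e: "e \<in> E"
  shows "pair (row p e) (rotation p) = 0"
  using e
proof (cases rule: edge_cases)
  case PP
  then have "pair (row p e) (rotation p) = (p (s e) - p (t e)) \<bullet> (rot90 (p (s e)) - rot90 (p (t e)))"
    by (simp add: pair_row[OF e] rotation_def)
  then show ?thesis by (simp add: inner_2 algebra_simps)
next
  case PL
  then show ?thesis using unit[of "t e"] inner_rot90_swap[of "a (t e)" "p (s e)"]
    by (simp add: pair_row[OF e] rotation_def norm_eq_1)
next
  case LL
  then show ?thesis using unit[of "t e"] unit[of "s e"]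
    by (simp add: pair_row[OF e] rotation_def norm_eq_1)
qed

lemma pair_rows_rotation: "F \<subseteq> E \<Longrightarrow> x \<in> span (row p ` F) \<Longrightarrow> pair x (rotation p) = 0"
  using pairing_span_eq_0[of "row p ` F" "VP \<union> VL" "rotation p" x] pair_row_rotation
  by (auto simp: pairing_commute)

text \<open>A tangent pairs to 1 with the rotation, so the hypothesis leaves only point-point edges,
  whose ends it makes coincide.\<close>

lemma row_eq_0:
  assumes e: "e \<in> E" and z: "pair (u e) (rotation p) = 0" "pair (v e) (rotation p) = 0"
  shows "row p e = 0"
  using e
proof (cases rule: edge_cases)
  case PP
  then have "p (s e) = p (t e)" using z
    by (simp add: u_def v_def pairing_simps pair_delta rotation_def vec_eq_iff forall_2 inner_axis')
  then show ?thesis using PP by (simp add: row_def)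
next
  case PL
  then show ?thesis using z pair_eps_rotation[of "t e" p] by (simp add: v_def)
next
  case LL
  then show ?thesis using z pair_eps_rotation[of "t e" p] by (simp add: v_def)
qed

lemma motion_iff:
  assumes F: "F \<subseteq> E"
  shows "infinitesimal_motion VP VL F p a p' a' \<longleftrightarrow>
    (\<forall>j\<in>VL. a j \<bullet> a' j = 0) \<and>
    (\<forall>e\<in>F. pair (row p e) (\<lambda>x. if x \<in> VP then p' x else if x \<in> VL then a' x else 0) = 0)"
    (is "_ \<longleftrightarrow> ?L \<and> (\<forall>e\<in>F. pair (row p e) ?m = 0)")
proof (cases ?L)
  case True
  \<comment> \<open>The condition at line \<open>j\<close> leaves one unknown, the coefficient of
    the tangent.\<close>
  have w: "a' j = (rot90 (a j) \<bullet> a' j) *\<^sub>R rot90 (a j)" if "j \<in> VL" for j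
    using perp_unit_eq[OF unit[OF that]] True that by blast
  have LL: "a i \<bullet> a' j + a' i \<bullet> a j
      = (a i \<bullet> rot90 (a j)) * (rot90 (a j) \<bullet> a' j - rot90 (a i) \<bullet> a' i)"
    if "i \<in> VL" "j \<in> VL" for i j
  proof -
    have "a i \<bullet> a' j = (rot90 (a j) \<bullet> a' j) * (a i \<bullet> rot90 (a j))"
      using arg_cong[OF w[OF that(2)], of "\<lambda>y. a i \<bullet> y"] by simp
    moreover have "a' i \<bullet> a j = (rot90 (a i) \<bullet> a' i) * (a j \<bullet> rot90 (a i))"
      using arg_cong[OF w[OF that(1)], of "\<lambda>y. a j \<bullet> y"] by (simp add: inner_commute)
    ultimately show ?thesis using inner_rot90_swap[of "a i" "a j"] by (simp add: algebra_simps)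
  qed
  have PL: "p i \<bullet> a' j + p' i \<bullet> a j = a j \<bullet> p' i + (p i \<bullet> rot90 (a j)) * (rot90 (a j) \<bullet> a' j)"
    if "j \<in> VL" for i j
    using arg_cong[OF w[OF that], of "\<lambda>y. p i \<bullet> y"] by (simp add: inner_commute)
  have ij: "{s e, t e} = e" if "e \<in> F" for e using that F ends(1) by blast
  show ?thesis
  proof
    assume M: "infinitesimal_motion VP VL F p a p' a'"
    have "pair (row p e) ?m = 0" if e: "e \<in> F" for e
    proof -
      have eE: "e \<in> E" using e F by blast
      from eE show ?thesis
      proof (cases rule: edge_cases)
        case PP
        then show ?thesis using M ij[OF e] e unfolding infinitesimal_motion_def pair_row[OF eE] by simp
      next
        case PL': PL
        then show ?thesis using M ij[OF e] e PL[of "t e" "s e"]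
          unfolding infinitesimal_motion_def pair_row[OF eE] by simp
      next
        case LL': LL
        then have "a (s e) \<bullet> a' (t e) + a' (s e) \<bullet> a (t e) = 0"
          using M ij[OF e] e unfolding infinitesimal_motion_def by simp
        then show ?thesis using LL' LL[of "s e" "t e"] unfolding pair_row[OF eE] by simp
      qed
    qed
    then show "?L \<and> (\<forall>e\<in>F. pair (row p e) ?m = 0)" using True by blast
  next
    assume R: "?L \<and> (\<forall>e\<in>F. pair (row p e) ?m = 0)"
    \<comment> \<open>The orientation fixes the order of the ends only for point-line edges; the
      other constraints are symmetric in \<open>i\<close> and \<open>j\<close>.\<close>
    have R': "pair (row p {i, j}) ?m = 0" "{i, j} \<in> E" "s {i, j} = i \<and> t {i, j} = j \<or> s {i, j} = j \<and> t {i, j} = i"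
      if "{i, j} \<in> F" for i j
      using R that F ij[OF that] by (auto simp: doubleton_eq_iff)
    show "infinitesimal_motion VP VL F p a p' a'"
      unfolding infinitesimal_motion_def
    proof (intro conjI ballI impI)
      fix i j assume ij: "i \<in> VP" "j \<in> VP" "{i, j} \<in> F"
      from R'(3)[OF ij(3)] R'(1)[OF ij(3)] ij
      show "(p i - p j) \<bullet> (p' i - p' j) = 0"
        unfolding pair_row[OF R'(2)[OF ij(3)]] by (auto simp: inner_diff algebra_simps)
    next
      fix i j assume ij: "i \<in> VP" "j \<in> VL" "{i, j} \<in> F"
      then have "j \<notin> VP" "i \<notin> VL" using disj by auto
      then have "s {i, j} = i" "t {i, j} = j"
        using R'(3)[OF ij(3)] kinds[OF R'(2)[OF ij(3)]] ij by auto
      with R'(1)[OF ij(3)] ij \<open>j \<notin> VP\<close> show "p i \<bullet> a' j + p' i \<bullet> a j = 0"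
        unfolding pair_row[OF R'(2)[OF ij(3)]] PL[OF ij(2)] by simp
    next
      fix i j assume ij: "i \<in> VL" "j \<in> VL" "{i, j} \<in> F"
      then have n: "j \<notin> VP" "i \<notin> VP" using disj by auto
      from R'(3)[OF ij(3)] show "a i \<bullet> a' j + a' i \<bullet> a j = 0"
      proof
        assume "s {i, j} = i \<and> t {i, j} = j"
        with R'(1)[OF ij(3)] ij n show ?thesis
          unfolding pair_row[OF R'(2)[OF ij(3)]] LL[OF ij(1,2)] by simp
      next
        assume "s {i, j} = j \<and> t {i, j} = i"
        with R'(1)[OF ij(3)] ij n have "a j \<bullet> a' i + a' j \<bullet> a i = 0"
          unfolding pair_row[OF R'(2)[OF ij(3)]] LL[OF ij(2,1)] by simp
        then show ?thesis by (simp add: inner_commute add.commute)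
      qed
    qed (use True in blast)
  qed
qed (auto simp: infinitesimal_motion_def)

section \<open>Rigidity as a spanning property\<close>

lemma pair_rotation_rotation:
  assumes "VL \<noteq> {}"
  shows "pair (rotation p) (rotation p) \<noteq> 0"
proof
  assume z: "pair (rotation p) (rotation p) = 0"
  obtain j where j: "j \<in> VL" using assms by blast
  have "rotation p j = 0" by (rule pairing_self_eq_0[OF _ z]) (use fin j in auto)
  then show False using j VL_not_VP[OF j] unit[OF j] by (simp add: rotation_def)
qed

text \<open>Motions are the candidates orthogonal to the rows. Rigidity thus says that only 0 is
  orthogonal to the rows and to the rotation, that is, that these span all candidates.\<close>

lemma rigid_iff_span:
  assumes F: "F \<subseteq> E" and VL: "VL \<noteq> {}"
  shows "inf_fixed_intercept_rigid VP VL F p a \<longleftrightarrow>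
    motion_gens \<subseteq> span (insert (rotation p) (row p ` F))"
proof
  let ?G = "insert (rotation p) (row p ` F)"
  have finG: "finite ?G" using finite_subset[OF F finE] by simp
  have finV: "finite (VP \<union> VL)" using fin by simp
  {
    assume R: "inf_fixed_intercept_rigid VP VL F p a"
    show "motion_gens \<subseteq> span ?G"
    proof
      fix k assume k: "k \<in> motion_gens"
      \<comment> \<open>The projection error of \<open>k\<close> is a motion; rigidity makes it a
        multiple of the rotation, to which it is orthogonal, so it is 0.\<close>
      obtain y where y: "y \<in> span ?G" "\<forall>g\<in>?G. pair (k - y) g = 0"
        using ex_pairing_projection[OF finV finG] by blast
      define m where "m = k - y"
      have "?G \<subseteq> span motion_gens" using F row_motion_gens rotation_motion_gens by blast
      then have "y \<in> span motion_gens" using y(1) span_minimal[OF _ subspace_span] by blast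
      then have mK: "m \<in> span motion_gens" unfolding m_def using k by (blast intro: span_diff span_base)
      then have m0: "m x = 0" if "x \<notin> VP \<union> VL" for x using that in_span_motion_gens_iff by blast
      then have meq: "(\<lambda>x. if x \<in> VP then m x else if x \<in> VL then m x else 0) = m" by (auto simp: fun_eq_iff)
      have "infinitesimal_motion VP VL F p a m m"
        unfolding motion_iff[OF F] meq
        using mK y(2) by (auto simp: in_span_motion_gens_iff m_def pairing_commute)
      then obtain w where w: "\<forall>i\<in>VP. m i = w *\<^sub>R rot90 (p i)" "\<forall>j\<in>VL. m j = w *\<^sub>R rot90 (a j)"
        using R unfolding inf_fixed_intercept_rigid_def infinitesimal_rotation_def by blast
      have mw: "m = w *\<^sub>R rotation p"
        using w m0 by (auto simp: fun_eq_iff rotation_def)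
      have "pair m (rotation p) = 0" using y(2) by (simp add: m_def)
      then have "w = 0" using pair_rotation_rotation[OF VL] by (simp add: mw pairing_simps)
      then have "k = y" using mw by (simp add: m_def)
      then show "k \<in> span ?G" using y(1) by simp
    qed
  }
  assume S: "motion_gens \<subseteq> span ?G"
  show "inf_fixed_intercept_rigid VP VL F p a"
    unfolding inf_fixed_intercept_rigid_def
  proof (intro allI impI)
    fix p' a' assume M: "infinitesimal_motion VP VL F p a p' a'"
    define m where "m = (\<lambda>x. if x \<in> VP then p' x else if x \<in> VL then a' x else 0)"
    have row0: "\<forall>e\<in>F. pair (row p e) m = 0" and L: "\<forall>j\<in>VL. a j \<bullet> a' j = 0"
      using M unfolding motion_iff[OF F] m_def by auto
    have mK: "m \<in> span motion_gens"
      using L VL_not_VP by (auto simp: in_span_motion_gens_iff m_def)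
    \<comment> \<open>Removing the component along the rotation leaves a vector that lies in the
      span of \<open>?G\<close> and is orthogonal to it.\<close>
    define c where "c = pair m (rotation p) / pair (rotation p) (rotation p)"
    define m' where "m' = m - c *\<^sub>R rotation p"
    have "pair m' (rotation p) = 0"
      using pair_rotation_rotation[OF VL] by (simp add: m'_def c_def pairing_simps)
    moreover have "pair m' (row p e) = 0" if "e \<in> F" for e
      using row0 that pair_row_rotation[of e p] F
      by (auto simp: m'_def pairing_simps pairing_commute[of _ _ "row p e"])
    ultimately have G0: "\<forall>g\<in>?G. pair m' g = 0" by blast
    have "m' \<in> span motion_gens"
      unfolding m'_def using mK rotation_motion_gens by (intro span_diff span_scale)
    then have "m' \<in> span ?G" using S span_minimal[OF _ subspace_span] by blast
    then have "pair m' m' = 0" using pairing_span_eq_0[OF G0] by blast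
    then have "m' x = 0" if "x \<in> VP \<union> VL" for x using pairing_self_eq_0[OF finV _ that] by blast
    then have mx: "m x = c *\<^sub>R rotation p x" if "x \<in> VP \<union> VL" for x
      using that by (simp add: m'_def)
    show "infinitesimal_rotation VP VL p a p' a'"
      unfolding infinitesimal_rotation_def
    proof (intro exI[of _ c] conjI ballI)
      fix i assume "i \<in> VP"
      then show "p' i = c *\<^sub>R rot90 (p i)" using mx[of i] by (simp add: m_def rotation_def)
    next
      fix j assume "j \<in> VL"
      then show "a' j = c *\<^sub>R rot90 (a j)"
        using mx[of j] VL_not_VP by (simp add: m_def rotation_def)
    qed
  qed
qed

lemma rotation_notin_span_rows:
  "VL \<noteq> {} \<Longrightarrow> F \<subseteq> E \<Longrightarrow> rotation p \<notin> span (row p ` F)"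
  using pair_rows_rotation pair_rotation_rotation by blast

text \<open>A row in the span of the rotation and the other rows could be deleted without loss of
  rigidity. The rows and the rotation therefore form a basis of the candidate motions, the rotation
  being the extra 1 in the count.\<close>

lemma rows_independent_if_minimal:
  assumes M: "minimally_inf_fixed_intercept_rigid VP VL E p a" and VL: "VL \<noteq> {}"
  shows "inj_on (row p) E" "independent (row p ` E)" "card E + 1 = 2 * card VP + card VL"
proof -
  let ?r = "rotation p"
  have S: "motion_gens \<subseteq> span (insert ?r (row p ` E))"
    using M rigid_iff_span[OF order_refl VL] unfolding minimally_inf_fixed_intercept_rigid_def by blast
  have notin: "row p e \<notin> span (insert ?r (row p ` (E - {e})))" if e: "e \<in> E" for e
  proof
    assume r: "row p e \<in> span (insert ?r (row p ` (E - {e})))"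
    have "insert ?r (row p ` E) \<subseteq> span (insert ?r (row p ` (E - {e})))"
      using r by (auto intro: span_base)
    then have "motion_gens \<subseteq> span (insert ?r (row p ` (E - {e})))"
      using S span_minimal[OF _ subspace_span] by blast
    then have "inf_fixed_intercept_rigid VP VL (E - {e}) p a"
      using rigid_iff_span[of "E - {e}" p] VL by blast
    then show False using M e unfolding minimally_inf_fixed_intercept_rigid_def by blast
  qed
  show inj: "inj_on (row p) E"
  proof (rule inj_onI, rule ccontr)
    fix e e' assume "e \<in> E" "e' \<in> E" "row p e = row p e'" "e \<noteq> e'"
    then have "row p e \<in> insert ?r (row p ` (E - {e}))" by auto
    then show False using notin[OF \<open>e \<in> E\<close>] span_base[of "row p e"] by simp
  qed
  show ind: "independent (row p ` E)"
    unfolding dependent_def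
  proof clarify
    fix e assume e: "e \<in> E" "row p e \<in> span (row p ` E - {row p e})"
    have "span (row p ` E - {row p e}) \<subseteq> span (insert ?r (row p ` (E - {e})))"
      by (rule span_mono) auto
    then show False using notin[OF e(1)] e(2) by blast
  qed
  have rot: "?r \<notin> span (row p ` E)" using rotation_notin_span_rows[OF VL order_refl] .
  then have i: "independent (insert ?r (row p ` E))" by (rule independent_insertI[OF _ ind])
  have "span (insert ?r (row p ` E)) = span motion_gens"
    by (rule span_eq[THEN iffD2]) (use S row_motion_gens rotation_motion_gens in blast)
  then have "dim motion_gens = card (insert ?r (row p ` E))"
    using dim_eq_card[OF _ i] by blast
  moreover have "?r \<notin> row p ` E" using rot span_superset[of "row p ` E"] by blast
  ultimately show "card E + 1 = 2 * card VP + card VL"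
    using finE card_image[OF inj] by (simp add: dim_motion_gens)
qed

text \<open>The rows of \<open>F\<close> lie in the hyperplane orthogonal to the rotation. The plane
  of an edge with nonzero row leaves it, which yields one more independent vector.\<close>

lemma edge_space_bound_if_independent:
  assumes inj: "inj_on (row p) E" and ind: "independent (row p ` E)"
    and F: "F \<subseteq> E" "F \<noteq> {}"
  shows "card F + 1 \<le> dim (edge_space F)"
proof -
  obtain e where e: "e \<in> F" "e \<in> E" using F by blast
  have "row p e \<noteq> 0" using ind imageI[OF e(2), of "row p"] dependent_zero[of "row p ` E"] by auto
  then obtain x where x: "x \<in> {u e, v e}" "pair x (rotation p) \<noteq> 0"
    using row_eq_0[OF e(2)] by blast
  have xn: "x \<notin> span (row p ` F)" using pair_rows_rotation[OF F(1)] x(2) by blast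
  have "independent (row p ` F)" using independent_mono[OF ind] F by blast
  then have i: "independent (insert x (row p ` F))" by (rule independent_insertI[OF xn])
  have "row p e' \<in> span (edge_space F)" if "e' \<in> F" for e'
  proof -
    have "span {u e', v e'} \<subseteq> span (edge_space F)" using that by (intro span_mono) blast
    then show ?thesis using row_in_span[of e' p] that F by blast
  qed
  then have sub: "insert x (row p ` F) \<subseteq> span (edge_space F)"
    using x(1) e(1) by (auto intro: span_base)
  have finF: "finite F" using finite_subset[OF F(1) finE] .
  have "card (insert x (row p ` F)) \<le> dim (edge_space F)"
    by (rule independent_card_le_dim_finite(2)[OF _ i sub]) (use finF in simp)
  moreover have "x \<notin> row p ` F" using xn span_superset[of "row p ` F"] by blast
  ultimately show ?thesis
    using finF card_image[OF inj_on_subset[OF inj F(1)]] by simp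
qed

text \<open>With the rotation, the rows are as many independent vectors as the dimension, hence
  span; with one row fewer they cannot. Independence is stated by coefficients, which also rules out
  equal rows of different edges.\<close>

lemma minimal_if_independent:
  assumes ind: "\<And>c. (\<Sum>e\<in>E. c e *\<^sub>R row p e) = 0 \<Longrightarrow> \<forall>e\<in>E. c e = 0"
    and card: "card E + 1 = 2 * card VP + card VL" and VL: "VL \<noteq> {}"
  shows "minimally_inf_fixed_intercept_rigid VP VL E p a"
proof -
  let ?r = "rotation p"
  have inj: "inj_on (row p) E"
  proof (rule inj_onI, rule ccontr)
    fix e e' assume e: "e \<in> E" "e' \<in> E" "row p e = row p e'" "e \<noteq> e'"
    define c :: "'v set \<Rightarrow> real" where "c f = (if f = e then 1 else if f = e' then - 1 else 0)" for f
    have "(\<Sum>f\<in>E. c f *\<^sub>R row p f) = (\<Sum>f\<in>{e, e'}. c f *\<^sub>R row p f)"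
      by (rule sum.mono_neutral_right) (use e finE in \<open>auto simp: c_def\<close>)
    also have "\<dots> = 0" using e by (simp add: c_def)
    finally have "c e = 0" using ind e by blast
    then show False by (simp add: c_def)
  qed
  have "independent (row p ` E)"
  proof (rule independent_if_scalars_zero)
    fix f x assume s: "(\<Sum>x\<in>row p ` E. f x *\<^sub>R x) = 0" and x: "x \<in> row p ` E"
    have "(\<Sum>e\<in>E. f (row p e) *\<^sub>R row p e) = 0" using s by (simp add: sum.reindex[OF inj])
    then show "f x = 0" using ind[of "\<lambda>e. f (row p e)"] x by blast
  qed (use finE in simp)
  moreover have rot: "?r \<notin> span (row p ` E)" using rotation_notin_span_rows[OF VL order_refl] .
  ultimately have i: "independent (insert ?r (row p ` E))" by (intro independent_insertI)
  have "?r \<notin> row p ` E" using rot span_superset[of "row p ` E"] by blast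
  then have "dim (insert ?r (row p ` E)) = dim motion_gens"
    using dim_eq_card_independent[OF i] finE card_image[OF inj] card by (simp add: dim_motion_gens)
  moreover have "insert ?r (row p ` E) \<subseteq> span motion_gens"
    using row_motion_gens rotation_motion_gens by blast
  ultimately have "motion_gens \<subseteq> span (insert ?r (row p ` E))"
    using subset_span_if_dim_le[OF fin_motion_gens] by (metis order_refl)
  then have R: "inf_fixed_intercept_rigid VP VL E p a" using rigid_iff_span[OF order_refl VL] by blast
  have "\<not> inf_fixed_intercept_rigid VP VL (E - {e}) p a" if e: "e \<in> E" for e
  proof
    assume "inf_fixed_intercept_rigid VP VL (E - {e}) p a"
    then have sub: "motion_gens \<subseteq> span (insert ?r (row p ` (E - {e})))"
      using rigid_iff_span[of "E - {e}" p] VL by blast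
    have finG: "finite (insert ?r (row p ` (E - {e})))" using finE by simp
    have "dim motion_gens \<le> card (insert ?r (row p ` (E - {e})))" by (rule dim_le_card[OF sub finG])
    also have "\<dots> \<le> Suc (card (row p ` (E - {e})))" by (simp add: card_insert_if finE)
    also have "\<dots> \<le> Suc (card (E - {e}))" using card_image_le[of "E - {e}" "row p"] finE by simp
    also have "\<dots> = card E" using card_Suc_Diff1[OF finE e] .
    finally show False using card by (simp add: dim_motion_gens)
  qed
  with R show ?thesis unfolding minimally_inf_fixed_intercept_rigid_def by blast
qed

text \<open>The generic functional \<open>h\<close> dictates \<open>p\<close> and scalings of the
  lines under which \<open>h\<close> becomes the pairing with the rotation. The rescaled rows then
  lie in the kernel of \<open>h\<close> and in their planes, where generic position gives
  independence.\<close>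

lemma ex_realisation:
  assumes VL: "VL \<noteq> {}" and card: "card E + 1 = 2 * card VP + card VL"
    and LL: "\<And>i j. i \<in> VL \<Longrightarrow> j \<in> VL \<Longrightarrow> {i, j} \<in> E \<Longrightarrow> a i \<noteq> a j \<and> a i \<noteq> - a j"
    and bound: "\<And>F. F \<subseteq> E \<Longrightarrow> F \<noteq> {} \<Longrightarrow> card F + 1 \<le> dim (edge_space F)"
  shows "\<exists>p. minimally_inf_fixed_intercept_rigid VP VL E p a"
proof -
  have eps0: "eps j \<noteq> 0" if "j \<in> VL" for j
  proof
    assume "eps j = 0"
    then have "eps j j = 0" by simp
    then show False using unit[OF that] by (simp add: eps_def delta_apply)
  qed
  have dims: "\<forall>F\<subseteq>E. F \<noteq> {} \<longrightarrow> card F + 1 + dim ({} :: ('v \<Rightarrow> real^2) set) \<le> dim ({} \<union> edge_space F)"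
    using bound by (simp add: dim_eq_card_independent independent_empty)
  \<comment> \<open>With the tangents as \<open>Z\<close>, the functional is nonzero at each of them
    and can be normalised.\<close>
  have disj: "eps ` VL \<inter> span {} = {}" using eps0 by auto
  from generic_hyperplane_section[OF finE finite.emptyI finite_imageI[OF fin(2)] disj dims]
  obtain h :: "('v \<Rightarrow> real^2) \<Rightarrow> real" where h: "linear h" "\<forall>z\<in>eps ` VL. h z \<noteq> 0"
    "\<forall>e\<in>E. h (u e) \<noteq> 0 \<or> h (v e) \<noteq> 0" and
    hr: "\<forall>r. (\<forall>e\<in>E. r e \<in> span {u e, v e} \<and> h (r e) = 0 \<and> r e \<noteq> 0) \<longrightarrow>
       (\<forall>c. (\<Sum>e\<in>E. c e *\<^sub>R r e) \<in> span {} \<longrightarrow> (\<forall>e\<in>E. c e = 0))"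
    by (elim exE conjE) rule
  have hl: "h (eps j) \<noteq> 0" if "j \<in> VL" for j using h(2) that by blast
  \<comment> \<open>Solves \<open>h (delta i b) = b \<bullet> rot90 (p i)\<close> for
    \<open>p i\<close>, using the two axes as \<open>b\<close>.\<close>
  define p :: "'v \<Rightarrow> real^2" where "p i = vector [h (delta i (axis 2 1)), - h (delta i (axis 1 1))]" for i
  \<comment> \<open>The pairing with a rotation takes the value 1 at every \<open>eps j\<close>; \<open>D\<close> normalises \<open>h\<close> to this.\<close>
  define D :: "('v \<Rightarrow> real^2) \<Rightarrow> 'v \<Rightarrow> real^2" where
    "D f x = (if x \<in> VL then inverse (h (eps x)) *\<^sub>R f x else f x)" for f x
  have linD: "linear D" by (rule linearI) (auto simp: D_def fun_eq_iff algebra_simps)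
  have injD: "f = 0" if "D f = 0" for f
  proof
    fix x
    have "D f x = 0" using that by simp
    then show "f x = 0 x" using hl by (auto simp: D_def split: if_splits)
  qed
  have D_delta: "D (delta i b) = delta i b" if "i \<in> VP" for i b
    using that VL_not_VP by (auto simp: D_def fun_eq_iff delta_apply)
  have D_eps: "D (eps j) = inverse (h (eps j)) *\<^sub>R eps j" if "j \<in> VL" for j
    using that by (auto simp: D_def fun_eq_iff delta_apply eps_def)
  have p_inner: "h (delta i b) = b \<bullet> rot90 (p i)" for i b
  proof -
    have "delta i b = b $ 1 *\<^sub>R delta i (axis 1 1) + b $ 2 *\<^sub>R delta i (axis 2 1)"
      by (subst vec2_axis[of b]) (simp only: linear_add[OF linear_delta] linear_cmul[OF linear_delta])
    then have "h (delta i b) = b $ 1 * h (delta i (axis 1 1)) + b $ 2 * h (delta i (axis 2 1))"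
      using h(1) by (simp add: linear_add linear_cmul)
    then show ?thesis by (simp add: inner_2 p_def)
  qed
  have hD: "h (D f) = pair f (rotation p)" if "f \<in> span motion_gens" for f
    using that
  proof (induction rule: span_induct_alt)
    case base
    show ?case by (simp only: linear_0[OF linD] linear_0[OF h(1)] pairing_simps)
  next
    case (step c f g)
    then obtain x where "x \<in> VP \<and> f \<in> range (delta x) \<or> x \<in> VL \<and> f = eps x"
      by (auto simp: motion_gens_def eps_def split: if_splits)
    then have "h (D f) = pair f (rotation p)"
    proof
      assume "x \<in> VP \<and> f \<in> range (delta x)"
      then show ?thesis by (auto simp: D_delta p_inner pair_delta rotation_def)
    next
      assume "x \<in> VL \<and> f = eps x"
      then show ?thesis using hl[of x] by (simp add: D_eps linear_cmul[OF h(1)] pair_eps_rotation)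
    qed
    with step(2) show ?case
      by (simp only: linear_add[OF linD] linear_add[OF h(1)] linear_cmul[OF linD] linear_cmul[OF h(1)]
          pairing_simps real_scaleR_def)
  qed
  \<comment> \<open>\<open>D\<close> maps each of \<open>u e\<close> and \<open>v e\<close> to a
    multiple of itself.\<close>
  have D_uv: "{D (u e), D (v e)} \<subseteq> span {u e, v e}" if "e \<in> E" for e
    using that
  proof (cases rule: edge_cases)
    case PP
    then show ?thesis
      by (simp add: u_def v_def linear_diff[OF linD] D_delta span_base)
  next
    case PL
    then show ?thesis by (simp add: u_def v_def D_delta D_eps span_base span_scale)
  next
    case LL
    then show ?thesis by (simp add: u_def v_def D_eps span_base span_scale)
  qed
  \<comment> \<open>Coincident ends of a point-point edge would make \<open>h\<close> vanish on its
    plane, a normal is never 0, and lines joined by an edge are distinct.\<close>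
  have row_nz: "row p e \<noteq> 0" if e: "e \<in> E" for e
  proof
    assume z: "row p e = 0"
    from e show False
    proof (cases rule: edge_cases)
      case PP
      have st: "s e \<noteq> t e" using ends(2)[OF e] .
      have "row p e (s e) = 0" using z by simp
      then have "p (s e) = p (t e)" using PP st by (simp add: row_def delta_apply)
      then have "h (u e) = 0" "h (v e) = 0"
        using PP by (simp_all add: u_def v_def linear_diff[OF h(1)] p_inner)
      then show False using h(3) e by blast
    next
      case PL
      have "row p e (s e) = 0" using z by simp
      then have "a (t e) = 0" using PL ends(2)[OF e] by (simp add: row_def delta_apply eps_def)
      then show False using unit[OF PL(2)] by simp
    next
      case LL': LL
      have "row p e (t e) = 0" using z by simp
      then have "(a (s e) \<bullet> rot90 (a (t e))) *\<^sub>R rot90 (a (t e)) = 0"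
        using LL' ends(2)[OF e] by (simp add: row_def delta_apply eps_def)
      moreover have "a (t e) \<noteq> 0" using unit[OF LL'(2)] by auto
      ultimately have "a (s e) \<bullet> rot90 (a (t e)) = 0" by simp
      then have "a (s e) = a (t e) \<or> a (s e) = - a (t e)"
        using inner_rot90_eq_0_unit[OF unit[OF LL'(1)] unit[OF LL'(2)]] by blast
      moreover have "{s e, t e} \<in> E" using ends(1)[OF e] e by simp
      ultimately show False using LL[OF LL'(1,2)] by blast
    qed
  qed
  have "D (row p e) \<in> span {u e, v e} \<and> h (D (row p e)) = 0 \<and> D (row p e) \<noteq> 0" if e: "e \<in> E" for e
  proof (intro conjI)
    have "D (row p e) \<in> D ` span {u e, v e}" using row_in_span[OF e] by blast
    also have "\<dots> = span (D ` {u e, v e})" by (rule linear_span_image[OF linD, symmetric])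
    also have "\<dots> \<subseteq> span {u e, v e}" using D_uv[OF e] by (intro span_minimal) auto
    finally show "D (row p e) \<in> span {u e, v e}" .
    show "h (D (row p e)) = 0" using hD[OF row_motion_gens[OF e]] pair_row_rotation[OF e] by simp
    show "D (row p e) \<noteq> 0" using injD row_nz[OF e] by blast
  qed
  then have Dind: "\<forall>c. (\<Sum>e\<in>E. c e *\<^sub>R D (row p e)) \<in> span {} \<longrightarrow> (\<forall>e\<in>E. c e = 0)"
    using hr[rule_format, of "\<lambda>e. D (row p e)"] by blast
  have "\<forall>e\<in>E. c e = 0" if c: "(\<Sum>e\<in>E. c e *\<^sub>R row p e) = 0" for c
  proof -
    have "(\<Sum>e\<in>E. c e *\<^sub>R D (row p e)) = D (\<Sum>e\<in>E. c e *\<^sub>R row p e)"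
      by (simp only: linear_sum[OF linD] linear_cmul[OF linD])
    also have "\<dots> = 0" unfolding c by (rule linear_0[OF linD])
    finally have "(\<Sum>e\<in>E. c e *\<^sub>R D (row p e)) \<in> span {}" by (simp only: span_zero)
    then show ?thesis using Dind by blast
  qed
  then show ?thesis using minimal_if_independent[OF _ card VL] by blast
qed

end

theorem theorem4p4:
  fixes VP VL :: "'v set" and E :: "'v set set" and a :: "'v \<Rightarrow> real^2"
  assumes "point_line_graph VP VL E"
    and "card VL \<ge> 2"
    and "\<forall>i\<in>VL. a i \<in> sphere 0 1"
  shows "(\<exists>p. line_concurrent_framework VP VL E p a \<and>
              minimally_inf_fixed_intercept_rigid VP VL E p a)
    \<longleftrightarrow>
     (int (card E) = 2 * int (card VP) + int (card VL) - 1 \<and>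
      (\<forall>i\<in>VL. \<forall>j\<in>VL. {i, j} \<in> E \<longrightarrow> a i \<noteq> a j \<and> a i \<noteq> - a j) \<and>
      (\<forall>F. F \<subseteq> E \<and> F \<noteq> {} \<longrightarrow>
         int (card F) \<le> 2 * int (num_incident VP F) + int (num_incident VL F) - 1
           - (\<Sum>H\<in>point_components VP VL F.
                2 - int (dim (span (component_normals VL F a H))))))"
    (is "_ \<longleftrightarrow> ?card \<and> ?LL \<and> (\<forall>F. F \<subseteq> E \<and> F \<noteq> {} \<longrightarrow> ?bound F)")
proof -
  \<comment> \<open>Every edge is oriented so that a point precedes a line.\<close>
  have "\<exists>st. e = {fst st, snd st} \<and> fst st \<noteq> snd st \<and>
      (fst st \<in> VP \<and> snd st \<in> VP \<or> fst st \<in> VP \<and> snd st \<in> VL \<or> fst st \<in> VL \<and> snd st \<in> VL)"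
    if e: "e \<in> E" for e
  proof -
    obtain x y where xy: "x \<in> VP \<union> VL" "y \<in> VP \<union> VL" "x \<noteq> y" "e = {x, y}"
      using assms(1) e unfolding point_line_graph_def by blast
    then have "e = {y, x}" by blast
    show ?thesis
    proof (cases "x \<in> VL \<and> y \<in> VP")
      case True
      with xy \<open>e = {y, x}\<close> show ?thesis by (intro exI[of _ "(y, x)"]) simp
    next
      case False
      with xy show ?thesis by (intro exI[of _ "(x, y)"]) auto
    qed
  qed
  then obtain st where st: "\<And>e. e \<in> E \<Longrightarrow> e = {fst (st e), snd (st e)} \<and> fst (st e) \<noteq> snd (st e) \<and>
      (fst (st e) \<in> VP \<and> snd (st e) \<in> VP \<or> fst (st e) \<in> VP \<and> snd (st e) \<in> VL
        \<or> fst (st e) \<in> VL \<and> snd (st e) \<in> VL)" by metis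
  interpret oriented_point_line_graph VP VL E "\<lambda>e. fst (st e)" "\<lambda>e. snd (st e)" a
    by unfold_locales (use assms st in \<open>auto simp: point_line_graph_def\<close>)
  have VL: "VL \<noteq> {}" using assms(2) by auto
  have framework: "line_concurrent_framework VP VL E p a" for p
    using assms by (simp add: line_concurrent_framework_def)
  \<comment> \<open>Apart from the 1, the right side of the bound is the dimension of the edge
    space.\<close>
  have bound_iff: "?bound F \<longleftrightarrow> card F + 1 \<le> dim (edge_space F)" if "F \<subseteq> E" for F
    using dim_edge_space[OF that] by linarith
  show ?thesis
  proof
    assume "\<exists>p. line_concurrent_framework VP VL E p a \<and> minimally_inf_fixed_intercept_rigid VP VL E p a"
    then obtain p where p: "minimally_inf_fixed_intercept_rigid VP VL E p a" by blast
    note ind = rows_independent_if_minimal[OF p VL]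
    have "a i \<noteq> a j \<and> a i \<noteq> - a j" if ij: "i \<in> VL" "j \<in> VL" "{i, j} \<in> E" for i j
    proof (rule ccontr)
      let ?e = "{i, j}"
      assume "\<not> (a i \<noteq> a j \<and> a i \<noteq> - a j)"
      \<comment> \<open>Equal or antipodal normals make the row of the edge 0 in either orientation,
        against independence.\<close>
      then have z: "a i \<bullet> rot90 (a j) = 0" "a j \<bullet> rot90 (a i) = 0"
        using inner_rot90_eq_0_unit[OF unit[OF ij(1)] unit[OF ij(2)]] inner_rot90_swap[of "a j" "a i"] by auto
      have "fst (st ?e) = i \<and> snd (st ?e) = j \<or> fst (st ?e) = j \<and> snd (st ?e) = i"
        using st[OF ij(3)] by (metis doubleton_eq_iff)
      then have "row p ?e = 0" using z ij VL_not_VP by (auto simp: row_def)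
      then show False using ind(2) imageI[OF ij(3), of "row p"] dependent_zero[of "row p ` E"] by simp
    qed
    moreover have "?bound F" if "F \<subseteq> E" "F \<noteq> {}" for F
      using bound_iff[OF that(1)] edge_space_bound_if_independent[OF ind(1,2) that] by blast
    moreover have ?card using ind(3) by linarith
    ultimately show "?card \<and> ?LL \<and> (\<forall>F. F \<subseteq> E \<and> F \<noteq> {} \<longrightarrow> ?bound F)" by blast
  next
    assume R: "?card \<and> ?LL \<and> (\<forall>F. F \<subseteq> E \<and> F \<noteq> {} \<longrightarrow> ?bound F)"
    have "\<exists>p. minimally_inf_fixed_intercept_rigid VP VL E p a"
    proof (rule ex_realisation[OF VL])
      show "card E + 1 = 2 * card VP + card VL" using R by linarith
      show "card F + 1 \<le> dim (edge_space F)" if "F \<subseteq> E" "F \<noteq> {}" for F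
        using R bound_iff that by blast
    qed (use R in blast)
    then show "\<exists>p. line_concurrent_framework VP VL E p a \<and> minimally_inf_fixed_intercept_rigid VP VL E p a"
      using framework by blast
  qed
qed

end
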